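(* Let $\mathcal V$ and $\mathcal V^n$ be the variance processes given by $$d\mathcal V(t)=\mathfrak C\mathcal V(t)\,dt+d\mathcal L(t),\ \ \mathcal V(0)=\mathcal V_0,\qquad d\mathcal V^n(t)=\mathfrak C^n\mathcal V^n(t)\,dt+d\mathcal L^n(t),\ \ \mathcal V^n(0)=\mathcal V^n_0,$$ and suppose that $\mathcal V(t)$ and $\mathcal V^n(t)$ are non-negative definite. Then for every $T>0$, $$\mathbb E\Big[\sup_{0\le t\le T}\big\|\sqrt{\mathcal V(t)}-\sqrt{\mathcal V^n(t)}\big\|_{\mathrm{op}}^2\Big]\le\mathbb E\Big[\sup_{0\le t\le T}\|\mathcal V(t)-\mathcal V^n(t)\|_{\mathrm{op}}\Big].$$
   Context: $H$ is a separable real Hilbert space and $\mathcal H=L_{HS}(H)$ is the Hilbert space of Hilbert-Schmidt operators on $H$; $\|\cdot\|_{\mathrm{op}}$ is the operator norm (here on $L(H)$). $\mathfrak C,\mathfrak C^n\in L(\mathcal H)$ are bounded operators, $\mathcal V_0,\mathcal V_0^n$ are $\mathcal H$-valued initial values, and $\mathcal L(t)=\sum_{i=1}^{N(t)}\mathcal X_i$, $\mathcal L^n(t)=\sum_{i=1}^{N(t)}\mathcal X_i^n$ are $\mathcal H$-valued compound Poisson processes driven by the same Poisson process $N$ of intensity $\lambda>0$. The solution is $\mathcal V(t)=e^{\mathfrak Ct}\mathcal V_0+\int_0^te^{\mathfrak C(t-s)}d\mathcal L(s)$, an $\mathcal H$-valued process; similarly for $\mathcal V^n$. "Non-negative definite"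 operators are self-adjoint, and $\sqrt A$ denotes the unique non-negative definite operator with $\sqrt A\sqrt A=A$. *)

theory Defs
  imports "HOL-Probability.Probability"
begin

section \<open>Orthonormal bases\<close>

definition orthonormal :: "'a::real_inner set \<Rightarrow> bool" where
  "orthonormal B \<longleftrightarrow> (\<forall>e\<in>B. norm e = 1) \<and> pairwise orthogonal B"

definition orthonormal_basis :: "'a::real_inner set \<Rightarrow> bool" where
  "orthonormal_basis B \<longleftrightarrow> orthonormal B \<and> closure (span B) = UNIV"

lemma orthonormal_inner:
  "orthonormal B \<Longrightarrow> e \<in> B \<Longrightarrow> f \<in> B \<Longrightarrow> e \<bullet> f = (if e = f then 1 else 0)"
  by (auto simp: orthonormal_def pairwise_def orthogonal_def dot_square_norm)

lemma orthonormal_norm_sum: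
  assumes "orthonormal B" "finite F" "F \<subseteq> B"
  shows "(norm (\<Sum>e\<in>F. c e *\<^sub>R e))\<^sup>2 = (\<Sum>e\<in>F. (c e)\<^sup>2)"
proof -
  have "(norm (\<Sum>e\<in>F. c e *\<^sub>R e))\<^sup>2 = (\<Sum>e\<in>F. \<Sum>f\<in>F. (c e * c f) * (e \<bullet> f))"
    unfolding power2_norm_eq_inner inner_sum_left unfolding inner_sum_right
    by (simp add: mult_ac)
  also have "\<dots> = (\<Sum>e\<in>F. \<Sum>f\<in>F. if e = f then c e * c f else 0)"
    using assms by (intro sum.cong refl) (auto simp: orthonormal_inner subset_iff)
  also have "\<dots> = (\<Sum>e\<in>F. (c e)\<^sup>2)"
    using assms(2) by (intro sum.cong refl) (simp add: power2_eq_square)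
  finally show ?thesis .
qed

lemma bessel:
  assumes "orthonormal B" "finite F" "F \<subseteq> B"
  shows "(\<Sum>e\<in>F. (x \<bullet> e)\<^sup>2) \<le> (norm x)\<^sup>2"
proof -
  let ?s = "\<Sum>e\<in>F. (x \<bullet> e) *\<^sub>R e"
  have "x \<bullet> ?s = (\<Sum>e\<in>F. (x \<bullet> e)\<^sup>2)"
    by (simp add: inner_sum_right power2_eq_square)
  then have "(norm (x - ?s))\<^sup>2 = (norm x)\<^sup>2 - (\<Sum>e\<in>F. (x \<bullet> e)\<^sup>2)"
    using orthonormal_norm_sum[OF assms, of "\<lambda>e. x \<bullet> e"]
    by (simp add: power2_norm_eq_inner inner_diff inner_commute)
  then show ?thesis
    using zero_le_power2[of "norm (x - ?s)"] by linarith
qed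

lemma orthonormal_summable:
  fixes B :: "'a::{real_inner,banach} set"
  assumes B: "orthonormal B" and c: "(\<lambda>e. (c e)\<^sup>2) summable_on B"
  shows "(\<lambda>e. c e *\<^sub>R e) summable_on B"
proof -
  let ?q = "\<lambda>e. (c e)\<^sup>2" and ?f = "\<lambda>e. c e *\<^sub>R e"
  define L where "L = infsum ?q B"
  have lim: "(sum ?q \<longlongrightarrow> L) (finite_subsets_at_top B)"
    using c by (simp add: L_def infsum_tendsto)
  have "\<exists>P. eventually P (finite_subsets_at_top B) \<and>
          (\<forall>F F'. P F \<and> P F' \<longrightarrow> dist (sum ?f F) (sum ?f F') < r)" if "r > 0" for r
  proof -
    define d where "d = (r/2)\<^sup>2"
    have "d > 0" using that by (simp add: d_def)
    then have "\<forall>\<^sub>F F in finite_subsets_at_top B. dist (sum ?q F) L < d"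
      using lim by (simp add: tendsto_iff)
    then obtain F0 where F0: "finite F0" "F0 \<subseteq> B"
        "\<And>F. finite F \<Longrightarrow> F0 \<subseteq> F \<Longrightarrow> F \<subseteq> B \<Longrightarrow> dist (sum ?q F) L < d"
      by (auto simp: eventually_finite_subsets_at_top)
    have near: "dist (sum ?f F) (sum ?f F0) < r/2"
      if F: "finite F" "F0 \<subseteq> F" "F \<subseteq> B" for F
    proof -
      have "(dist (sum ?f F) (sum ?f F0))\<^sup>2 = (norm (sum ?f (F - F0)))\<^sup>2"
        using F by (simp add: dist_norm sum_diff)
      also have "\<dots> = sum ?q (F - F0)"
        using F by (intro orthonormal_norm_sum[OF B]) auto
      also have "\<dots> = sum ?q F - sum ?q F0"
        using F by (simp add: sum_diff)
      also have "\<dots> < d"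
      proof -
        have "sum ?q F \<le> L"
          unfolding L_def using F c by (intro finite_sum_le_infsum) auto
        moreover have "dist (sum ?q F0) L < d" using F0 by auto
        ultimately show ?thesis unfolding dist_real_def by linarith
      qed
      finally show ?thesis
        unfolding d_def by (rule power2_less_imp_less) (use \<open>r > 0\<close> in simp)
    qed
    show ?thesis
    proof (intro exI conjI allI impI)
      show "\<forall>\<^sub>F F in finite_subsets_at_top B. finite F \<and> F0 \<subseteq> F \<and> F \<subseteq> B"
        using F0 by (auto simp: eventually_finite_subsets_at_top)
      fix F F' assume "(finite F \<and> F0 \<subseteq> F \<and> F \<subseteq> B) \<and> finite F' \<and> F0 \<subseteq> F' \<and> F' \<subseteq> B"
      then show "dist (sum ?f F) (sum ?f F') < r"
        using near[of F] near[of F'] dist_triangle2[of "sum ?f F" "sum ?f F'" "sum ?f F0"]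
        by linarith
    qed
  qed
  then have "cauchy_filter (filtermap (sum ?f) (finite_subsets_at_top B))"
    by (simp add: cauchy_filter_metric_filtermap)
  moreover have "uniform_space_class.complete (UNIV::'a set)"
    by (meson Cauchy_convergent UNIV_I complete_def convergent_def)
  ultimately obtain L' where "(sum ?f \<longlongrightarrow> L') (finite_subsets_at_top B)"
    using complete_uniform[where S=UNIV] by (force simp add: filterlim_def)
  then show ?thesis
    using summable_on_def has_sum_def by blast
qed

lemma bessel_summable:
  assumes "orthonormal B"
  shows "(\<lambda>e. (x \<bullet> e)\<^sup>2) summable_on B"
  using bessel[OF assms]
  by (intro nonneg_bdd_above_summable_on bdd_aboveI2[where M = "(norm x)\<^sup>2"]) auto

lemma expansion_orthogonal:
  fixes B :: "'a::{real_inner,banach} set"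
  assumes B: "orthonormal B" and "f \<in> B"
    and c: "((\<lambda>e. c e *\<^sub>R e) has_sum y) B"
  shows "y \<bullet> f = c f"
proof -
  have "((\<lambda>e. (c e *\<^sub>R e) \<bullet> f) has_sum y \<bullet> f) B"
    by (rule has_sum_bounded_linear[OF bounded_linear_inner_left c])
  moreover have "((\<lambda>e. (c e *\<^sub>R e) \<bullet> f) has_sum c f) B"
    using assms
    by (intro has_sum_finite_neutralI[of "{f}"]) (auto simp: orthonormal_inner)
  ultimately show ?thesis by (rule has_sum_unique)
qed

lemma orthonormal_basis_expansion:
  fixes B :: "'a::{real_inner,banach} set"
  assumes "orthonormal_basis B"
  shows "((\<lambda>e. (x \<bullet> e) *\<^sub>R e) has_sum x) B"
proof -
  have B: "orthonormal B" and cl: "closure (span B) = UNIV"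
    using assms by (auto simp: orthonormal_basis_def)
  obtain y where y: "((\<lambda>e. (x \<bullet> e) *\<^sub>R e) has_sum y) B"
    using orthonormal_summable[OF B bessel_summable[OF B]] by (auto simp: summable_on_def)
  have "(x - y) \<bullet> f = 0" if "f \<in> B" for f
    using expansion_orthogonal[OF B that y] by (simp add: inner_diff)
  then have "span B \<subseteq> {z. (x - y) \<bullet> z = 0}"
    by (intro span_minimal subspaceI) (auto simp: inner_add_right)
  moreover have "closed {z. (x - y) \<bullet> z = 0}"
    by (intro closed_Collect_eq continuous_intros)
  ultimately have "closure (span B) \<subseteq> {z. (x - y) \<bullet> z = 0}"
    by (rule closure_minimal)
  then have "x - y \<in> {z. (x - y) \<bullet> z = 0}" using cl by blast
  then have "x = y" by simp
  then show ?thesis using y by simp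
qed

lemma parseval:
  fixes B :: "'a::{real_inner,banach} set"
  assumes "orthonormal_basis B"
  shows "((\<lambda>e. (x \<bullet> e)\<^sup>2) has_sum (norm x)\<^sup>2) B"
  using has_sum_bounded_linear[OF bounded_linear_inner_right[of x] orthonormal_basis_expansion[OF assms, of x]]
  by (simp add: power2_eq_square dot_square_norm)

lemma orthonormal_basis_exists: "\<exists>B :: 'a::{real_inner,banach} set. orthonormal_basis B"
proof -
  have "\<exists>M\<in>Collect orthonormal. \<forall>X\<in>Collect orthonormal. M \<subseteq> X \<longrightarrow> X = (M :: 'a set)"
  proof (rule Zorn_Lemma, rule ballI)
    fix C :: "'a set set" assume C: "C \<in> chains (Collect orthonormal)"
    then have "\<And>X. X \<in> C \<Longrightarrow> orthonormal X" by (auto dest: chainsD2)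
    moreover have "pairwise orthogonal (\<Union>C)"
      using C by (intro pairwise_chain_Union)
        (auto simp: orthonormal_def chains_def dest: chainsD2)
    ultimately show "\<Union>C \<in> Collect orthonormal"
      by (auto simp: orthonormal_def)
  qed
  then obtain M :: "'a set" where M: "orthonormal M"
    and max: "\<And>X. orthonormal X \<Longrightarrow> M \<subseteq> X \<Longrightarrow> X = M" by auto
  have "x \<in> closure (span M)" for x
  proof -
    obtain y where y: "((\<lambda>e. (x \<bullet> e) *\<^sub>R e) has_sum y) M"
      using orthonormal_summable[OF M bessel_summable[OF M]] by (auto simp: summable_on_def)
    have orth: "(x - y) \<bullet> f = 0" if "f \<in> M" for f
      using expansion_orthogonal[OF M that y] by (simp add: inner_diff)
    have "x = y"
    proof (rule ccontr)
      assume "x \<noteq> y"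
      define u where "u = (x - y) /\<^sub>R norm (x - y)"
      have u: "norm u = 1" using \<open>x \<noteq> y\<close> by (simp add: u_def)
      have uf: "u \<bullet> f = 0" if "f \<in> M" for f using orth[OF that] by (simp add: u_def)
      have "orthonormal (insert u M)"
        using M u uf by (auto simp: orthonormal_def pairwise_insert orthogonal_def inner_commute)
      then have "u \<in> M" using max by blast
      then show False using uf[of u] u by (simp add: dot_square_norm)
    qed
    then have "(sum (\<lambda>e. (x \<bullet> e) *\<^sub>R e) \<longlongrightarrow> x) (finite_subsets_at_top M)"
      using y by (simp add: has_sum_def)
    moreover have "\<forall>\<^sub>F F in finite_subsets_at_top M. (\<Sum>e\<in>F. (x \<bullet> e) *\<^sub>R e) \<in> closure (span M)"
      by (intro eventually_finite_subsets_at_top_weakI subsetD[OF closure_subset] span_sum span_scale)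
        (auto intro: span_base)
    ultimately show ?thesis
      by (intro Lim_in_closed_set[where F = "finite_subsets_at_top M"]) auto
  qed
  then show ?thesis using M by (auto simp: orthonormal_basis_def)
qed

section \<open>Hilbert-Schmidt operators\<close>

definition hilbert_schmidt :: "('a::{real_inner,banach} \<Rightarrow>\<^sub>L 'a) \<Rightarrow> bool" where
  "hilbert_schmidt A \<longleftrightarrow> (\<exists>B. orthonormal_basis B \<and> (\<lambda>e. (norm (A e))\<^sup>2) summable_on B)"

lemma adjoint_exists:
  fixes A :: "'a::{real_inner,banach} \<Rightarrow>\<^sub>L 'a"
  obtains A' where "\<And>x y. A x \<bullet> y = x \<bullet> A' y"
proof -
  obtain B :: "'a set" where B: "orthonormal_basis B" using orthonormal_basis_exists by blast
  then have B': "orthonormal B" by (simp add: orthonormal_basis_def)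
  have "\<exists>z. \<forall>x. A x \<bullet> y = x \<bullet> z" for y
  proof -
    let ?p = "\<lambda>x. A x \<bullet> y"
    have bl: "bounded_linear ?p"
      by (intro bounded_linear_compose[OF bounded_linear_inner_left] blinfun.bounded_linear_right)
    have bnd: "(\<Sum>e\<in>F. (?p e)\<^sup>2) \<le> (norm A * norm y)\<^sup>2" if F: "finite F" "F \<subseteq> B" for F
    proof -
      define s where "s = (\<Sum>e\<in>F. ?p e *\<^sub>R e)"
      define S where "S = (\<Sum>e\<in>F. (?p e)\<^sup>2)"
      have S: "(norm s)\<^sup>2 = S" unfolding s_def S_def by (rule orthonormal_norm_sum[OF B' F])
      have "S = ?p s"
        by (simp add: s_def S_def blinfun.sum_right blinfun.scaleR_right inner_sum_left power2_eq_square)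
      also have "\<dots> \<le> norm (A s) * norm y" by (rule norm_cauchy_schwarz)
      also have "\<dots> \<le> (norm A * norm s) * norm y"
        by (intro mult_right_mono norm_blinfun) auto
      finally have "norm s * norm s \<le> (norm A * norm y) * norm s"
        using S by (simp add: power2_eq_square mult_ac)
      then have "norm s \<le> norm A * norm y"
        by (cases "norm s = 0") (auto simp: mult_le_cancel_right)
      then show ?thesis using S unfolding S_def by (metis norm_ge_zero power_mono)
    qed
    have "(\<lambda>e. (?p e)\<^sup>2) summable_on B"
      using bnd by (intro nonneg_bdd_above_summable_on bdd_aboveI2[where M = "(norm A * norm y)\<^sup>2"]) auto
    from orthonormal_summable[OF B' this]
    obtain z where z: "((\<lambda>e. ?p e *\<^sub>R e) has_sum z) B" by (auto simp: summable_on_def)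
    have "?p x = x \<bullet> z" for x
    proof -
      have "((\<lambda>e. ?p ((x \<bullet> e) *\<^sub>R e)) has_sum ?p x) B"
        by (rule has_sum_bounded_linear[OF bl orthonormal_basis_expansion[OF B]])
      moreover have "((\<lambda>e. x \<bullet> (?p e *\<^sub>R e)) has_sum x \<bullet> z) B"
        by (rule has_sum_bounded_linear[OF bounded_linear_inner_right z])
      ultimately show ?thesis
        by (auto simp: blinfun.scaleR_right mult.commute intro: has_sum_unique)
    qed
    then show ?thesis by blast
  qed
  then have "\<exists>A'. \<forall>x y. A x \<bullet> y = x \<bullet> A' y" by metis
  then show ?thesis using that by blast
qed

lemma hs_sum_adjoint:
  fixes a b :: "'a::{real_inner,banach} \<Rightarrow> 'a"
  assumes E: "orthonormal_basis E" and F: "orthonormal_basis F"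
    and adj: "\<And>x y. a x \<bullet> y = x \<bullet> b y"
    and S: "((\<lambda>e. (norm (a e))\<^sup>2) has_sum S) E"
  shows "((\<lambda>f. (norm (b f))\<^sup>2) has_sum S) F"
proof -
  let ?g = "\<lambda>(e,f). (a e \<bullet> f)\<^sup>2"
  have 1: "((\<lambda>f. ?g (e, f)) has_sum (norm (a e))\<^sup>2) F" for e
    using parseval[OF F] by simp
  have "?g summable_on E \<times> F"
    using S by (intro summable_on_SigmaI[OF 1]) (auto simp: summable_on_def)
  from has_sum_SigmaI[OF 1 S this]
  have "(?g has_sum S) (E \<times> F)" .
  then have "((\<lambda>(f,e). ?g (e,f)) has_sum S) (F \<times> E)" by (subst (asm) has_sum_swap)
  moreover have "((\<lambda>e. (case (f, e) of (f,e) \<Rightarrow> ?g (e,f))) has_sum (norm (b f))\<^sup>2) E" for f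
    using parseval[OF E, of "b f"] by (simp add: adj inner_commute[of "b f"])
  ultimately show ?thesis by (rule has_sum_SigmaD)
qed

text \<open>The square sum does not depend on the orthonormal basis.\<close>

lemma hs_sum_basis_independent:
  fixes A :: "'a::{real_inner,banach} \<Rightarrow>\<^sub>L 'a"
  assumes "orthonormal_basis E" "orthonormal_basis F"
    and "((\<lambda>e. (norm (A e))\<^sup>2) has_sum S) E"
  shows "((\<lambda>f. (norm (A f))\<^sup>2) has_sum S) F"
proof -
  obtain A' where A': "\<And>x y. A x \<bullet> y = x \<bullet> A' y" by (rule adjoint_exists) blast
  have A'': "A' x \<bullet> y = x \<bullet> A y" for x y by (metis A' inner_commute)
  show ?thesis
    using hs_sum_adjoint[OF assms(2) assms(2) A'' hs_sum_adjoint[OF assms(1,2) A' assms(3)]] .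
qed

lemma hilbert_schmidt_summable:
  assumes "hilbert_schmidt A" "orthonormal_basis B"
  shows "(\<lambda>e. (norm (A e))\<^sup>2) summable_on B"
proof -
  obtain E S where "orthonormal_basis E" "((\<lambda>e. (norm (A e))\<^sup>2) has_sum S) E"
    using assms(1) by (auto simp: hilbert_schmidt_def summable_on_def)
  from hs_sum_basis_independent[OF this(1) assms(2) this(2)] show ?thesis
    by (auto simp: summable_on_def)
qed

lemma norm_le_hs_sum:
  fixes A :: "'a::{real_inner,banach} \<Rightarrow>\<^sub>L 'a"
  assumes B: "orthonormal_basis B" and S: "((\<lambda>e. (norm (A e))\<^sup>2) has_sum S) B"
  shows "norm A \<le> sqrt S"
proof -
  obtain A' where A': "\<And>x y. A x \<bullet> y = x \<bullet> A' y" by (rule adjoint_exists) blast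
  have S': "((\<lambda>e. (norm (A' e))\<^sup>2) has_sum S) B" by (rule hs_sum_adjoint[OF B B A' S])
  have S0: "S \<ge> 0" using S by (rule has_sum_nonneg) simp
  have "norm (A x) \<le> sqrt S * norm x" for x
  proof -
    have "((\<lambda>e. (x \<bullet> A' e)\<^sup>2) has_sum (norm (A x))\<^sup>2) B"
      using parseval[OF B, of "A x"] by (simp add: A')
    moreover have "((\<lambda>e. (norm x)\<^sup>2 * (norm (A' e))\<^sup>2) has_sum (norm x)\<^sup>2 * S) B"
      by (rule has_sum_cmult_right[OF S'])
    moreover have "(x \<bullet> A' e)\<^sup>2 \<le> (norm x)\<^sup>2 * (norm (A' e))\<^sup>2" for e
      using Cauchy_Schwarz_ineq[of x "A' e"] by (simp add: dot_square_norm)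
    ultimately have "(norm (A x))\<^sup>2 \<le> (norm x)\<^sup>2 * S"
      by (rule has_sum_mono)
    also have "\<dots> = (sqrt S * norm x)\<^sup>2" using S0 by (simp add: power_mult_distrib)
    finally show ?thesis by (rule power2_le_imp_le) (use S0 in simp)
  qed
  then show ?thesis using S0 by (intro norm_blinfun_bound) auto
qed

lemma hilbert_schmidt_0: "hilbert_schmidt 0"
  using orthonormal_basis_exists by (auto simp: hilbert_schmidt_def)

lemma norm_add_sq_le: "(norm (x + y))\<^sup>2 \<le> 2 * (norm x)\<^sup>2 + 2 * (norm (y::'a::real_inner))\<^sup>2"
proof -
  have "(norm (x + y))\<^sup>2 + (norm (x - y))\<^sup>2 = 2 * (norm x)\<^sup>2 + 2 * (norm y)\<^sup>2"
    by (simp add: power2_norm_eq_inner inner_add inner_diff inner_commute)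
  then show ?thesis using zero_le_power2[of "norm (x - y)"] by linarith
qed

lemma hilbert_schmidt_add:
  assumes "hilbert_schmidt A" "hilbert_schmidt A'"
  shows "hilbert_schmidt (A + A')"
proof -
  obtain B :: "'a set" where B: "orthonormal_basis B" using orthonormal_basis_exists by blast
  have "(\<lambda>e. 2 * (norm (A e))\<^sup>2 + 2 * (norm (A' e))\<^sup>2) summable_on B"
    using assms B by (intro summable_on_add summable_on_cmult_right hilbert_schmidt_summable)
  then have "(\<lambda>e. (norm ((A + A') e))\<^sup>2) summable_on B"
    by (rule summable_on_comparison_test) (auto simp: blinfun.add_left norm_add_sq_le)
  then show ?thesis using B by (auto simp: hilbert_schmidt_def)
qed

lemma hilbert_schmidt_scaleR:
  assumes "hilbert_schmidt A"
  shows "hilbert_schmidt (c *\<^sub>R A)"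
proof -
  obtain B :: "'a set" where B: "orthonormal_basis B" using orthonormal_basis_exists by blast
  have "(\<lambda>e. c\<^sup>2 * (norm (A e))\<^sup>2) summable_on B"
    using assms B by (intro summable_on_cmult_right hilbert_schmidt_summable)
  then have "(\<lambda>e. (norm ((c *\<^sub>R A) e))\<^sup>2) summable_on B"
    by (simp add: blinfun.scaleR_left power_mult_distrib)
  then show ?thesis using B by (auto simp: hilbert_schmidt_def)
qed

lemma hilbert_schmidt_inner_summable:
  assumes "hilbert_schmidt A" "hilbert_schmidt A'" "orthonormal_basis B"
  shows "(\<lambda>e. A e \<bullet> A' e) summable_on B"
proof -
  have "(\<lambda>e. (norm (A e))\<^sup>2 + (norm (A' e))\<^sup>2) summable_on B"
    using assms by (intro summable_on_add hilbert_schmidt_summable)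
  moreover have "norm (A e \<bullet> A' e) \<le> (norm (A e))\<^sup>2 + (norm (A' e))\<^sup>2" for e
    using Cauchy_Schwarz_ineq2[of "A e" "A' e"] sum_squares_bound[of "norm (A e)" "norm (A' e)"]
      zero_le_power2[of "norm (A e)"] zero_le_power2[of "norm (A' e)"]
    unfolding real_norm_def by linarith
  ultimately have "(\<lambda>e. norm (A e \<bullet> A' e)) summable_on B"
    by (rule summable_on_comparison_test) auto
  then show ?thesis by (rule abs_summable_summable)
qed

text \<open>
  On type \<open>'a hs\<close> the norm is the Hilbert-Schmidt norm; the operator norm of \<open>A\<close> in
  \<open>L(H)\<close> is \<open>norm (hs_op A)\<close>. The inner product is formed in an arbitrary orthonormal basis;
  the induced norm is the same for every basis (\<open>norm_hs_has_sum\<close> below).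
\<close>

typedef (overloaded) 'a hs = "{A :: 'a::{real_inner,banach} \<Rightarrow>\<^sub>L 'a. hilbert_schmidt A}"
  morphisms hs_op Abs_hs
  using hilbert_schmidt_0 by blast

setup_lifting type_definition_hs

lemma hilbert_schmidt_hs_op [simp]: "hilbert_schmidt (hs_op A)"
  using hs_op[of A] by simp

instantiation hs :: ("{real_inner,banach}") real_inner
begin

lift_definition zero_hs :: "'a hs" is 0 by (rule hilbert_schmidt_0)

lift_definition plus_hs :: "'a hs \<Rightarrow> 'a hs \<Rightarrow> 'a hs" is "(+)" by (rule hilbert_schmidt_add)

lift_definition scaleR_hs :: "real \<Rightarrow> 'a hs \<Rightarrow> 'a hs" is "(*\<^sub>R)" by (rule hilbert_schmidt_scaleR)

lift_definition uminus_hs :: "'a hs \<Rightarrow> 'a hs" is uminus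
  using hilbert_schmidt_scaleR[of _ "-1"] by simp

lift_definition minus_hs :: "'a hs \<Rightarrow> 'a hs \<Rightarrow> 'a hs" is "(-)"
  using hilbert_schmidt_add hilbert_schmidt_scaleR[of _ "-1"] by (metis diff_conv_add_uminus scaleR_minus1_left)

definition inner_hs :: "'a hs \<Rightarrow> 'a hs \<Rightarrow> real" where
  "inner_hs A A' = (\<Sum>\<^sub>\<infinity>e\<in>(SOME B. orthonormal_basis B). hs_op A e \<bullet> hs_op A' e)"

definition norm_hs :: "'a hs \<Rightarrow> real" where
  "norm_hs A = sqrt (A \<bullet> A)"

definition sgn_hs :: "'a hs \<Rightarrow> 'a hs" where
  "sgn_hs A = scaleR (inverse (norm A)) A"

definition dist_hs :: "'a hs \<Rightarrow> 'a hs \<Rightarrow> real" where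
  "dist_hs A A' = norm (A - A')"

definition uniformity_hs :: "('a hs \<times> 'a hs) filter" where
  "uniformity_hs = (INF e\<in>{0<..}. principal {(A, A'). dist A A' < e})"

definition open_hs :: "'a hs set \<Rightarrow> bool" where
  "open_hs U \<longleftrightarrow> (\<forall>A\<in>U. \<forall>\<^sub>F (A', A'') in uniformity. A' = A \<longrightarrow> A'' \<in> U)"

instance
proof
  let ?B = "SOME B :: 'a set. orthonormal_basis B"
  have B: "orthonormal_basis ?B" by (rule someI_ex[OF orthonormal_basis_exists])
  note sm = hilbert_schmidt_inner_summable[OF hilbert_schmidt_hs_op hilbert_schmidt_hs_op B]
  fix x y z :: "'a hs" and a b :: real
  show "x + y + z = x + (y + z)" "x + y = y + x" "0 + x = x" "- x + x = 0" "x - y = x + - y"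
    "a *\<^sub>R (x + y) = a *\<^sub>R x + a *\<^sub>R y" "(a + b) *\<^sub>R x = a *\<^sub>R x + b *\<^sub>R x"
    "a *\<^sub>R b *\<^sub>R x = (a * b) *\<^sub>R x" "1 *\<^sub>R x = x"
    by (transfer; simp add: algebra_simps)+
  show "x \<bullet> y = y \<bullet> x" by (simp add: inner_hs_def inner_commute)
  show "(x + y) \<bullet> z = x \<bullet> z + y \<bullet> z"
    by (simp add: inner_hs_def plus_hs.rep_eq blinfun.add_left inner_add_left infsum_add sm)
  show "(a *\<^sub>R x) \<bullet> y = a * (x \<bullet> y)"
    by (simp add: inner_hs_def scaleR_hs.rep_eq blinfun.scaleR_left infsum_cmult_right sm)
  show "0 \<le> x \<bullet> x" by (simp add: inner_hs_def infsum_nonneg)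
  show "x \<bullet> x = 0 \<longleftrightarrow> x = 0"
  proof
    assume 0: "x \<bullet> x = 0"
    have "((\<lambda>e. (norm (hs_op x e))\<^sup>2) has_sum x \<bullet> x) ?B"
      using has_sum_infsum[OF sm[of x x]] by (simp add: inner_hs_def dot_square_norm)
    from norm_le_hs_sum[OF B this] 0 have "hs_op x = 0" by simp
    then show "x = 0" by (simp add: hs_op_inject[symmetric] zero_hs.rep_eq)
  qed (simp add: inner_hs_def zero_hs.rep_eq)
qed (simp_all add: norm_hs_def sgn_hs_def dist_hs_def uniformity_hs_def open_hs_def)

end

lemma norm_hs_has_sum:
  assumes "orthonormal_basis B"
  shows "((\<lambda>e. (norm (hs_op A e))\<^sup>2) has_sum (norm A)\<^sup>2) B"
proof -
  let ?B = "SOME B :: 'a set. orthonormal_basis B"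
  have B: "orthonormal_basis ?B" by (rule someI_ex[OF orthonormal_basis_exists])
  have "((\<lambda>e. hs_op A e \<bullet> hs_op A e) has_sum A \<bullet> A) ?B"
    unfolding inner_hs_def
    by (intro has_sum_infsum hilbert_schmidt_inner_summable hilbert_schmidt_hs_op B)
  then have "((\<lambda>e. (norm (hs_op A e))\<^sup>2) has_sum (norm A)\<^sup>2) ?B"
    by (simp only: dot_square_norm)
  from hs_sum_basis_independent[OF B assms this] show ?thesis .
qed

lemma norm_hs_op_le: "norm (hs_op A) \<le> norm A"
proof -
  obtain B :: "'a set" where B: "orthonormal_basis B" using orthonormal_basis_exists by blast
  from norm_le_hs_sum[OF B norm_hs_has_sum[OF B]] show ?thesis by simp
qed

lemma bounded_linear_hs_op: "bounded_linear hs_op"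
  by (rule bounded_linear_intro[where K = 1])
    (auto simp: plus_hs.rep_eq scaleR_hs.rep_eq norm_hs_op_le)

instance hs :: ("{real_inner,banach}") banach
proof
  fix X :: "nat \<Rightarrow> 'a hs" assume X: "Cauchy X"
  obtain B :: "'a set" where B: "orthonormal_basis B" using orthonormal_basis_exists by blast
  have "Cauchy (\<lambda>n. hs_op (X n))" by (rule bounded_linear.Cauchy[OF bounded_linear_hs_op X])
  then obtain A where A: "(\<lambda>n. hs_op (X n)) \<longlonglongrightarrow> A"
    using Cauchy_convergent convergent_def by blast
  have part: "\<exists>N. \<forall>n\<ge>N. \<forall>F. finite F \<longrightarrow> F \<subseteq> B \<longrightarrow> (\<Sum>e\<in>F. (norm ((hs_op (X n) - A) e))\<^sup>2) \<le> r\<^sup>2"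
    if "r > 0" for r
  proof -
    obtain N where N: "\<And>m n. m \<ge> N \<Longrightarrow> n \<ge> N \<Longrightarrow> norm (X m - X n) < r"
      using X \<open>r > 0\<close> by (auto simp: Cauchy_def dist_norm) blast
    have "(\<Sum>e\<in>F. (norm ((hs_op (X n) - A) e))\<^sup>2) \<le> r\<^sup>2" if "n \<ge> N" "finite F" "F \<subseteq> B" for n F
    proof (rule tendsto_upperbound)
      show "(\<lambda>m. \<Sum>e\<in>F. (norm ((hs_op (X n) - hs_op (X m)) e))\<^sup>2)
              \<longlonglongrightarrow> (\<Sum>e\<in>F. (norm ((hs_op (X n) - A) e))\<^sup>2)"
        by (intro tendsto_intros A)
      have "(\<Sum>e\<in>F. (norm ((hs_op (X n) - hs_op (X m)) e))\<^sup>2) \<le> r\<^sup>2" if "m \<ge> N" for m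
      proof -
        have "(\<Sum>e\<in>F. (norm (hs_op (X n - X m) e))\<^sup>2) \<le> (norm (X n - X m))\<^sup>2"
          using \<open>finite F\<close> \<open>F \<subseteq> B\<close> by (intro finite_sum_le_has_sum[OF norm_hs_has_sum[OF B]]) auto
        also have "\<dots> \<le> r\<^sup>2" using N[OF \<open>n \<ge> N\<close> that] by (intro power_mono) auto
        finally show ?thesis by (simp add: minus_hs.rep_eq)
      qed
      then show "\<forall>\<^sub>F m in sequentially. (\<Sum>e\<in>F. (norm ((hs_op (X n) - hs_op (X m)) e))\<^sup>2) \<le> r\<^sup>2"
        by (auto simp: eventually_sequentially)
    qed simp
    then show ?thesis by blast
  qed
  have hs: "hilbert_schmidt A"
  proof -
    obtain n where n: "\<And>F. finite F \<Longrightarrow> F \<subseteq> B \<Longrightarrow> (\<Sum>e\<in>F. (norm ((hs_op (X n) - A) e))\<^sup>2) \<le> 1"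
      using part[of 1] by auto
    have "(\<lambda>e. (norm ((hs_op (X n) - A) e))\<^sup>2) summable_on B"
      using n by (intro nonneg_bdd_above_summable_on bdd_aboveI2[where M = 1]) auto
    then have "hilbert_schmidt (hs_op (X n) - A)" using B by (auto simp: hilbert_schmidt_def)
    from hilbert_schmidt_add[OF hilbert_schmidt_hs_op[of "X n"] hilbert_schmidt_scaleR[OF this, of "-1"]]
    show ?thesis by simp
  qed
  have op: "hs_op (Abs_hs A) = A" using hs by (simp add: Abs_hs_inverse)
  have "X \<longlonglongrightarrow> Abs_hs A"
  proof (rule LIMSEQ_I)
    fix r :: real assume "r > 0"
    then obtain N where N: "\<And>n F. n \<ge> N \<Longrightarrow> finite F \<Longrightarrow> F \<subseteq> B \<Longrightarrow>
        (\<Sum>e\<in>F. (norm ((hs_op (X n) - A) e))\<^sup>2) \<le> (r/2)\<^sup>2"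
      using part[of "r/2"] by auto
    have "norm (X n - Abs_hs A) < r" if "n \<ge> N" for n
    proof -
      have "(norm (X n - Abs_hs A))\<^sup>2 \<le> (r/2)\<^sup>2"
        by (rule has_sum_le_finite_sums[OF norm_hs_has_sum[OF B]])
          (auto simp: minus_hs.rep_eq op N that)
      then have "norm (X n - Abs_hs A) \<le> r/2"
        by (rule power2_le_imp_le) (use \<open>r > 0\<close> in simp)
      then show ?thesis using \<open>r > 0\<close> by simp
    qed
    then show "\<exists>N. \<forall>n\<ge>N. norm (X n - Abs_hs A) < r" by blast
  qed
  then show "convergent X" by (auto simp: convergent_def)
qed

section \<open>Linear equations driven by jump paths\<close>

definition blinfun_exp :: "('b::banach \<Rightarrow>\<^sub>L 'b) \<Rightarrow> ('b \<Rightarrow>\<^sub>L 'b)" where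
  "blinfun_exp A = (\<Sum>k. (((\<lambda>D. A o\<^sub>L D) ^^ k) id_blinfun) /\<^sub>R fact k)"

text \<open>
  Pathwise meaning of \<open>dv = A v dt + dl\<close>, \<open>v(0) = v0\<close>, for a driving path with \<open>l(0) = 0\<close>:
  the integral equation \<open>v(t) = v0 + \<integral>\<^sub>0\<^sup>t A v(s) ds + l(t)\<close> on \<open>[0, \<infinity>)\<close>.
  The integral is continuous in \<open>t\<close>, so \<open>v\<close> inherits the path regularity of \<open>l\<close>; see
  \<open>langevin_path_iff\<close> for the explicit solution.
\<close>

definition langevin_path :: "('b::banach \<Rightarrow>\<^sub>L 'b) \<Rightarrow> 'b \<Rightarrow> (real \<Rightarrow> 'b) \<Rightarrow> (real \<Rightarrow> 'b) \<Rightarrow> bool" where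
  "langevin_path A v0 l v \<longleftrightarrow>
     (\<forall>t\<ge>0. ((\<lambda>s. A (v s)) has_integral (v t - v0 - l t)) {0..t})"

definition cadlag :: "(real \<Rightarrow> 'b::topological_space) \<Rightarrow> bool" where
  "cadlag f \<longleftrightarrow> (\<forall>t\<ge>0. (f \<longlongrightarrow> f t) (at_right t) \<and> (t > 0 \<longrightarrow> (\<exists>l. (f \<longlongrightarrow> l) (at_left t))))"

text \<open>
  For a counting path \<open>n\<close> with jump marks \<open>x\<close>, \<open>jump_sum n x\<close> is the pure jump path
  \<open>l(t) = x 1 + \<dots> + x (n t)\<close>, and \<open>jump_integral \<Phi> n x t\<close> is \<open>\<integral>\<^sub>0\<^sup>t \<Phi>(s) dl(s)\<close>,
  i.e. the sum of \<open>\<Phi>\<close> applied to the jumps up to time \<open>t\<close>.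
\<close>

definition jump_time :: "(real \<Rightarrow> nat) \<Rightarrow> nat \<Rightarrow> real" where
  "jump_time n i = Inf {t. 0 \<le> t \<and> i \<le> n t}"

definition jump_sum :: "(real \<Rightarrow> nat) \<Rightarrow> (nat \<Rightarrow> 'b::comm_monoid_add) \<Rightarrow> real \<Rightarrow> 'b" where
  "jump_sum n x t = (\<Sum>i=1..n t. x i)"

definition jump_integral :: "(real \<Rightarrow> 'b::banach \<Rightarrow>\<^sub>L 'b) \<Rightarrow> (real \<Rightarrow> nat) \<Rightarrow> (nat \<Rightarrow> 'b) \<Rightarrow> real \<Rightarrow> 'b" where
  "jump_integral \<Phi> n x t = (\<Sum>i=1..n t. \<Phi> (jump_time n i) (x i))"

lemma norm_blinfun_funpow:
  fixes A :: "'b::banach \<Rightarrow>\<^sub>L 'b"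
  shows "norm (((\<lambda>D. A o\<^sub>L D) ^^ k) id_blinfun) \<le> norm A ^ k"
proof (induction k)
  case (Suc k)
  have "norm (A o\<^sub>L (((\<lambda>D. A o\<^sub>L D) ^^ k) id_blinfun)) \<le> norm A * norm (((\<lambda>D. A o\<^sub>L D) ^^ k) id_blinfun)"
    by (rule norm_blinfun_compose)
  also have "\<dots> \<le> norm A * norm A ^ k" by (intro mult_left_mono Suc.IH) simp
  finally show ?case by simp
qed (simp add: norm_blinfun_id_le)

lemma blinfun_funpow_apply:
  fixes A :: "'b::banach \<Rightarrow>\<^sub>L 'b"
  shows "(((\<lambda>D. A o\<^sub>L D) ^^ k) id_blinfun) x = (blinfun_apply A ^^ k) x"
  by (induction k) auto

lemma blinfun_exp_apply_sums:
  fixes A :: "'b::banach \<Rightarrow>\<^sub>L 'b"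
  shows "(\<lambda>k. (blinfun_apply A ^^ k) x /\<^sub>R fact k) sums blinfun_exp A x"
proof -
  have "summable (\<lambda>k. (((\<lambda>D. A o\<^sub>L D) ^^ k) id_blinfun) /\<^sub>R fact k)"
  proof (rule summable_comparison_test)
    show "summable (\<lambda>k. norm A ^ k /\<^sub>R fact k)" by (rule summable_exp_generic)
    show "\<exists>N. \<forall>k\<ge>N. norm ((((\<lambda>D. A o\<^sub>L D) ^^ k) id_blinfun) /\<^sub>R fact k) \<le> norm A ^ k /\<^sub>R fact k"
      using norm_blinfun_funpow[of _ A] by (auto intro!: mult_left_mono)
  qed
  then have "(\<lambda>k. (((\<lambda>D. A o\<^sub>L D) ^^ k) id_blinfun) /\<^sub>R fact k) sums blinfun_exp A"
    by (simp add: blinfun_exp_def summable_sums)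
  from bounded_linear.sums[OF blinfun.bounded_linear_left this, of x]
  show ?thesis by (simp add: blinfun.scaleR_left blinfun_funpow_apply)
qed

lemma funpow_scaleR_blinfun:
  fixes A :: "'b::banach \<Rightarrow>\<^sub>L 'b"
  shows "(blinfun_apply (c *\<^sub>R A) ^^ k) x = c ^ k *\<^sub>R (blinfun_apply A ^^ k) x"
  by (induction k) (auto simp: blinfun.scaleR_left blinfun.scaleR_right)

lemma blinfun_exp_0 [simp]: "blinfun_exp (0::'b::banach \<Rightarrow>\<^sub>L 'b) x = x"
proof -
  have "(blinfun_apply (0::'b \<Rightarrow>\<^sub>L 'b) ^^ k) x /\<^sub>R fact k = (if k = 0 then x else 0)" for k
    by (cases k) auto
  then have "(\<lambda>k. if k = 0 then x else 0) sums blinfun_exp 0 x"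
    using blinfun_exp_apply_sums[of 0 x] by simp
  then show ?thesis using sums_single[of 0 "\<lambda>_. x"] sums_unique2 by fastforce
qed

lemma blinfun_exp_integral:
  fixes A :: "'b::banach \<Rightarrow>\<^sub>L 'b"
  assumes "t \<ge> 0"
  shows "((\<lambda>s. A (blinfun_exp (s *\<^sub>R A) x)) has_integral (blinfun_exp (t *\<^sub>R A) x - x)) {0..t}"
proof -
  let ?P = "\<lambda>k. (blinfun_apply A ^^ k) x"
  define f where "f = (\<lambda>k s. (s ^ k / fact k) *\<^sub>R ?P (Suc k))"
  define E where "E = (\<lambda>s. blinfun_exp (s *\<^sub>R A) x)"
  have E: "(\<lambda>k. (s ^ k / fact k) *\<^sub>R ?P k) sums E s" for s
    using blinfun_exp_apply_sums[of "s *\<^sub>R A" x]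
    by (simp add: E_def funpow_scaleR_blinfun divide_inverse mult.commute)
  have AE: "(\<lambda>k. f k s) sums A (E s)" for s
    using bounded_linear.sums[OF blinfun.bounded_linear_right E, of A s]
    by (simp add: f_def blinfun.scaleR_right)
  have norm_P: "norm (?P k) \<le> norm A ^ k * norm x" for k
    using norm_blinfun[of "((\<lambda>D. A o\<^sub>L D) ^^ k) id_blinfun" x] norm_blinfun_funpow[of k A]
    unfolding blinfun_funpow_apply by (meson mult_right_mono norm_ge_zero order_trans)
  have "uniform_limit {0..t} (\<lambda>m s. \<Sum>k<m. f k s) (\<lambda>s. suminf (\<lambda>k. f k s)) sequentially"
  proof (rule Weierstrass_m_test)
    show "norm (f k s) \<le> norm A * norm x * ((t * norm A) ^ k /\<^sub>R fact k)" if "s \<in> {0..t}" for k s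
    proof -
      have "norm (f k s) = (s ^ k / fact k) * norm (?P (Suc k))"
        using that by (simp add: f_def)
      also have "\<dots> \<le> (t ^ k / fact k) * (norm A ^ Suc k * norm x)"
        using that by (intro mult_mono norm_P divide_right_mono power_mono) auto
      finally show ?thesis by (simp add: field_simps power_mult_distrib)
    qed
    show "summable (\<lambda>k. norm A * norm x * ((t * norm A) ^ k /\<^sub>R fact k))"
      by (intro summable_mult summable_exp_generic)
  qed
  also have "(\<lambda>s. suminf (\<lambda>k. f k s)) = (\<lambda>s. A (E s))"
    using AE by (auto simp: sums_iff)
  finally have ul: "uniform_limit {0..t} (\<lambda>m s. \<Sum>k<m. f k s) (\<lambda>s. A (E s)) sequentially" .
  obtain I J where I: "\<And>m. ((\<lambda>s. \<Sum>k<m. f k s) has_integral I m) {0..t}"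
    and J: "((\<lambda>s. A (E s)) has_integral J) {0..t}" "I \<longlonglongrightarrow> J"
  proof (rule uniform_limit_integral[OF ul])
    show "continuous_on {0..t} (\<lambda>s. \<Sum>k<m. f k s)" for m
      unfolding f_def by (intro continuous_intros) auto
  qed auto
  let ?g = "\<lambda>k. (t ^ Suc k / fact (Suc k)) *\<^sub>R ?P (Suc k)"
  have "(f k has_integral ?g k) {0..t}" for k
  proof -
    have d: "((\<lambda>s. s ^ Suc k / fact (Suc k)) has_real_derivative s ^ k / fact k) (at s within {0..t})" for s
      by (auto intro!: derivative_eq_intros simp: field_simps simp del: power_Suc of_nat_Suc)
    have "((\<lambda>s. s ^ k / fact k) has_integral (t ^ Suc k / fact (Suc k) - 0 ^ Suc k / fact (Suc k))) {0..t}"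
      using assms d unfolding has_real_derivative_iff_has_vector_derivative
      by (intro fundamental_theorem_of_calculus) auto
    from has_integral_linear[OF this bounded_linear_scaleR_left[of "?P (Suc k)"]]
    show ?thesis by (simp add: f_def o_def)
  qed
  then have "((\<lambda>s. \<Sum>k<m. f k s) has_integral (\<Sum>k<m. ?g k)) {0..t}" for m
    by (intro has_integral_sum) auto
  then have "I = (\<lambda>m. \<Sum>k<m. ?g k)" using I has_integral_unique by blast
  then have "?g sums J" using J(2) unfolding sums_def by simp
  moreover have "?g sums (E t - x)"
    using E[of t] by (subst sums_Suc_iff) simp
  ultimately have "J = E t - x" by (rule sums_unique2)
  then show ?thesis using J(1) by (simp add: E_def)
qed

lemma blinfun_exp_integral_shifted:
  fixes A :: "'b::banach \<Rightarrow>\<^sub>L 'b"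
  assumes "\<tau> \<le> t"
  shows "((\<lambda>s. A (blinfun_exp ((s - \<tau>) *\<^sub>R A) x)) has_integral
           (blinfun_exp ((t - \<tau>) *\<^sub>R A) x - x)) {\<tau>..t}"
  using blinfun_exp_integral[of "t - \<tau>" A x] assms
    has_integral_shift_cbox_iff[of "\<lambda>s. A (blinfun_exp ((s - \<tau>) *\<^sub>R A) x)" \<tau> _ 0 "t - \<tau>"]
  by (simp add: o_def)

lemma jump_time_le_iff:
  assumes "cadlag n" and mono: "\<And>s t. 0 \<le> s \<Longrightarrow> s \<le> t \<Longrightarrow> n s \<le> n t"
    and "0 \<le> t" "i \<le> n t" "0 \<le> s"
  shows "jump_time n i \<le> s \<longleftrightarrow> i \<le> n s" and "0 \<le> jump_time n i"
proof -
  let ?S = "{t. 0 \<le> t \<and> i \<le> n t}" and ?\<tau> = "jump_time n i"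
  have ne: "?S \<noteq> {}" using assms by auto
  have bd: "bdd_below ?S" by (rule bdd_belowI[of _ 0]) auto
  show \<tau>: "0 \<le> ?\<tau>" unfolding jump_time_def using ne by (intro cInf_greatest) auto
  have "(n \<longlongrightarrow> n ?\<tau>) (at_right ?\<tau>)" using assms(1) \<tau> by (simp add: cadlag_def)
  then have "\<forall>\<^sub>F u in at_right ?\<tau>. n u = n ?\<tau>" by (rule tendsto_discrete[THEN iffD1])
  then obtain b where b: "b > ?\<tau>" "\<And>u. ?\<tau> < u \<Longrightarrow> u < b \<Longrightarrow> n u = n ?\<tau>"
    by (auto simp: eventually_at_right_field)
  obtain u where u: "u \<in> ?S" "u < b" using b(1) ne bd cInf_less_iff[of ?S b] by (auto simp: jump_time_def)
  have "?\<tau> \<le> u" unfolding jump_time_def using u bd by (intro cInf_lower)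
  then have "i \<le> n ?\<tau>" using u b(2)[of u] by (cases "u = ?\<tau>") auto
  then show "?\<tau> \<le> s \<longleftrightarrow> i \<le> n s"
    using mono[OF \<tau>, of s] bd assms(5) by (auto simp: jump_time_def intro: cInf_lower)
qed

lemma langevin_path_variation_of_constants:
  fixes A :: "'b::banach \<Rightarrow>\<^sub>L 'b"
  assumes n: "cadlag n" "\<And>s t. 0 \<le> s \<Longrightarrow> s \<le> t \<Longrightarrow> n s \<le> n t"
  shows "langevin_path A v0 (jump_sum n x)
    (\<lambda>t. blinfun_exp (t *\<^sub>R A) v0 + jump_integral (\<lambda>s. blinfun_exp ((t - s) *\<^sub>R A)) n x t)"
  unfolding langevin_path_def
proof (intro allI impI)
  fix t :: real assume t: "0 \<le> t"
  let ?\<tau> = "jump_time n" and ?E = "\<lambda>s. blinfun_exp (s *\<^sub>R A)"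
  let ?h = "\<lambda>i s. if s \<in> {?\<tau> i..t} then A (?E (s - ?\<tau> i) (x i)) else 0"
  have \<tau>: "0 \<le> ?\<tau> i" "\<And>s. 0 \<le> s \<Longrightarrow> ?\<tau> i \<le> s \<longleftrightarrow> i \<le> n s" if "i \<le> n t" for i
    using jump_time_le_iff[OF n t that] t by auto
  have "(?h i has_integral (?E (t - ?\<tau> i) (x i) - x i)) {0..t}" if "i \<in> {1..n t}" for i
    using that \<tau>[of i] t by (subst has_integral_restrict) (auto intro!: blinfun_exp_integral_shifted)
  then have "((\<lambda>s. A (?E s v0) + (\<Sum>i=1..n t. ?h i s)) has_integral
      ((?E t v0 - v0) + (\<Sum>i=1..n t. ?E (t - ?\<tau> i) (x i) - x i))) {0..t}"
    using t by (intro has_integral_add has_integral_sum blinfun_exp_integral) auto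
  moreover have "A (?E s v0) + (\<Sum>i=1..n t. ?h i s) =
      A (?E s v0 + jump_integral (\<lambda>u. ?E (s - u)) n x s)" if s: "s \<in> {0..t}" for s
  proof -
    have "n s \<le> n t" using n(2) s by auto
    then have "(\<Sum>i=1..n t. ?h i s) = (\<Sum>i=1..n s. A (?E (s - ?\<tau> i) (x i)))"
      using \<tau> s by (intro sum.mono_neutral_cong_right) auto
    then show ?thesis
      by (simp add: jump_integral_def blinfun.add_right blinfun.sum_right)
  qed
  ultimately have "((\<lambda>s. A (?E s v0 + jump_integral (\<lambda>u. ?E (s - u)) n x s)) has_integral
      ((?E t v0 - v0) + (\<Sum>i=1..n t. ?E (t - ?\<tau> i) (x i) - x i))) {0..t}"
    by (rule has_integral_eq[rotated])
  then show "((\<lambda>s. A (?E s v0 + jump_integral (\<lambda>u. ?E (s - u)) n x s)) has_integral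
      (?E t v0 + jump_integral (\<lambda>u. ?E (t - u)) n x t - v0 - jump_sum n x t)) {0..t}"
    by (simp add: jump_integral_def jump_sum_def sum_subtractf algebra_simps)
qed

lemma langevin_path_unique:
  fixes A :: "'b::banach \<Rightarrow>\<^sub>L 'b"
  assumes v: "langevin_path A v0 l v" and w: "langevin_path A v0 l w" and "0 \<le> t"
  shows "v t = w t"
proof -
  define d where "d = (\<lambda>s. v s - w s)"
  have int: "((\<lambda>u. A (d u)) has_integral d s) {0..s}" if "0 \<le> s" for s
  proof -
    have "((\<lambda>u. A (v u) - A (w u)) has_integral (v s - v0 - l s) - (w s - v0 - l s)) {0..s}"
      using v w that unfolding langevin_path_def by (intro has_integral_diff) auto
    then show ?thesis by (simp add: d_def blinfun.diff_right)
  qed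
  have "continuous_on {0..t} (\<lambda>s. integral {0..s} (\<lambda>u. A (d u)))"
    using int[OF \<open>0 \<le> t\<close>] by (intro indefinite_integral_continuous_1) blast
  then have cont: "continuous_on {0..t} d"
    by (rule continuous_on_eq) (auto simp: integral_unique[OF int])
  have "bounded (d ` {0..t})"
    by (intro compact_imp_bounded compact_continuous_image cont compact_Icc)
  then obtain K where "\<forall>s\<in>{0..t}. norm (d s) \<le> K" by (auto simp: bounded_iff)
  then have K: "\<And>s. s \<in> {0..t} \<Longrightarrow> norm (d s) \<le> K" by blast
  have bound: "\<forall>s\<in>{0..t}. norm (d s) \<le> K * ((norm A * s) ^ k / fact k)" for k
  proof (induction k)
    case 0 then show ?case using K by simp
  next
    case (Suc k)
    show ?case
    proof
      fix s assume s: "s \<in> {0..t}"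
      let ?c = "norm A * K * norm A ^ k"
      have d: "((\<lambda>u. u ^ Suc k / fact (Suc k)) has_real_derivative u ^ k / fact k) (at u within {0..s})" for u
        by (auto intro!: derivative_eq_intros simp: field_simps simp del: power_Suc of_nat_Suc)
      have "((\<lambda>u. u ^ k / fact k) has_integral (s ^ Suc k / fact (Suc k) - 0 ^ Suc k / fact (Suc k))) {0..s}"
        using s d unfolding has_real_derivative_iff_has_vector_derivative
        by (intro fundamental_theorem_of_calculus) auto
      from has_integral_mult_right[OF this, of ?c]
      have g: "((\<lambda>u. ?c * (u ^ k / fact k)) has_integral ?c * (s ^ Suc k / fact (Suc k))) {0..s}"
        by simp
      have "norm (integral {0..s} (\<lambda>u. A (d u))) \<le> integral {0..s} (\<lambda>u. ?c * (u ^ k / fact k))"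
      proof (rule integral_norm_bound_integral)
        fix u assume u: "u \<in> {0..s}"
        have "norm (A (d u)) \<le> norm A * norm (d u)" by (rule norm_blinfun)
        also have "\<dots> \<le> norm A * (K * ((norm A * u) ^ k / fact k))"
          using Suc.IH u s by (intro mult_left_mono) auto
        finally show "norm (A (d u)) \<le> ?c * (u ^ k / fact k)"
          by (simp add: power_mult_distrib mult_ac)
      qed (use int[of s] g s in auto)
      then have "norm (d s) \<le> ?c * (s ^ Suc k / fact (Suc k))"
        unfolding integral_unique[OF g] using integral_unique[OF int[of s]] s by simp
      then show "norm (d s) \<le> K * ((norm A * s) ^ Suc k / fact (Suc k))"
        by (simp add: power_mult_distrib mult_ac del: fact_Suc)
    qed
  qed
  have "(\<lambda>k. K * ((norm A * t) ^ k / fact k)) \<longlonglongrightarrow> K * 0"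
    using summable_LIMSEQ_zero[OF summable_exp_generic[of "norm A * t"]]
    by (intro tendsto_mult_left) (simp add: divide_inverse mult.commute)
  then have "norm (d t) \<le> K * 0"
    using bound \<open>0 \<le> t\<close> by (intro tendsto_lowerbound[where F = sequentially] always_eventually) auto
  then show ?thesis by (simp add: d_def)
qed

text \<open>
  The integral equation characterizes the variation-of-constants process
  \<open>exp(tA) v0 + \<integral>\<^sub>0\<^sup>t exp((t - s)A) dl(s)\<close>.
\<close>

theorem langevin_path_iff:
  fixes A :: "'b::banach \<Rightarrow>\<^sub>L 'b"
  assumes n: "cadlag n" "\<And>s t. 0 \<le> s \<Longrightarrow> s \<le> t \<Longrightarrow> n s \<le> n t"
  shows "langevin_path A v0 (jump_sum n x) v \<longleftrightarrow>
    (\<forall>t\<ge>0. v t = blinfun_exp (t *\<^sub>R A) v0 + jump_integral (\<lambda>s. blinfun_exp ((t - s) *\<^sub>R A)) n x t)"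
    (is "?L \<longleftrightarrow> (\<forall>t\<ge>0. v t = ?m t)")
proof
  note m = langevin_path_variation_of_constants[OF n, of A v0 x]
  show "\<forall>t\<ge>0. v t = ?m t" if ?L
    using langevin_path_unique[OF that m] by blast
  assume v: "\<forall>t\<ge>0. v t = ?m t"
  show ?L unfolding langevin_path_def
  proof (intro allI impI)
    fix t :: real assume t: "0 \<le> t"
    have "((\<lambda>s. A (?m s)) has_integral ?m t - v0 - jump_sum n x t) {0..t}"
      using m t unfolding langevin_path_def by blast
    then have "((\<lambda>s. A (v s)) has_integral ?m t - v0 - jump_sum n x t) {0..t}"
      by (rule has_integral_eq[rotated]) (use v in auto)
    then show "((\<lambda>s. A (v s)) has_integral v t - v0 - jump_sum n x t) {0..t}"
      using v t by simp
  qed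
qed

section \<open>Compound Poisson processes and variance processes\<close>

context prob_space
begin

definition poisson_process :: "real \<Rightarrow> (real \<Rightarrow> 'a \<Rightarrow> nat) \<Rightarrow> bool" where
  "poisson_process rate N \<longleftrightarrow>
     (\<forall>t\<ge>0. N t \<in> measurable M (count_space UNIV)) \<and>
     (AE \<omega> in M. N 0 \<omega> = 0) \<and>
     (AE \<omega> in M. cadlag (\<lambda>t. N t \<omega>)) \<and>
     (\<forall>s t k. 0 \<le> s \<longrightarrow> s < t \<longrightarrow>
        prob {\<omega> \<in> space M. N t \<omega> = N s \<omega> + k} = pmf (poisson_pmf (rate * (t - s))) k) \<and>
     (\<forall>m \<tau>. 0 \<le> \<tau> 0 \<longrightarrow> (\<forall>i<m. \<tau> i < \<tau> (Suc i)) \<longrightarrow>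
        indep_vars (\<lambda>_. count_space UNIV) (\<lambda>i \<omega>. int (N (\<tau> (Suc i)) \<omega>) - int (N (\<tau> i) \<omega>)) {..<m})"

text \<open>The jump marks are indexed from \<open>1\<close>.\<close>

definition compound_poisson :: "(real \<Rightarrow> 'a \<Rightarrow> nat) \<Rightarrow> real \<Rightarrow> (nat \<Rightarrow> 'a \<Rightarrow> 'b::topological_space) \<Rightarrow> bool" where
  "compound_poisson N rate X \<longleftrightarrow>
     poisson_process rate N \<and>
     indep_vars (\<lambda>_. borel) X {1..} \<and>
     (\<forall>i\<ge>1. distr M borel (X i) = distr M borel (X 1)) \<and>
     indep_set
       (sets (vimage_algebra (space M) (\<lambda>\<omega>. \<lambda>i\<in>{1..}. X i \<omega>) (\<Pi>\<^sub>M i\<in>{1..}. borel)))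
       (sets (vimage_algebra (space M) (\<lambda>\<omega>. \<lambda>t\<in>{0..}. N t \<omega>) (\<Pi>\<^sub>M t\<in>{0..}. count_space UNIV)))"

definition variance_process ::
  "('b::banach \<Rightarrow>\<^sub>L 'b) \<Rightarrow> ('a \<Rightarrow> 'b) \<Rightarrow> (real \<Rightarrow> 'a \<Rightarrow> nat) \<Rightarrow> (nat \<Rightarrow> 'a \<Rightarrow> 'b) \<Rightarrow> (real \<Rightarrow> 'a \<Rightarrow> 'b) \<Rightarrow> bool" where
  "variance_process C V0 N X V \<longleftrightarrow>
     (\<forall>t\<ge>0. V t \<in> borel_measurable M) \<and>
     (AE \<omega> in M. langevin_path C (V0 \<omega>) (jump_sum (\<lambda>t. N t \<omega>) (\<lambda>i. X i \<omega>)) (\<lambda>t. V t \<omega>))"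

end

section \<open>Non-negative definite operators and square roots\<close>

definition nonneg_definite :: "('a::real_inner \<Rightarrow>\<^sub>L 'a) \<Rightarrow> bool" where
  "nonneg_definite A \<longleftrightarrow> (\<forall>x y. A x \<bullet> y = x \<bullet> A y) \<and> (\<forall>x. 0 \<le> A x \<bullet> x)"

definition op_sqrt :: "('a::real_inner \<Rightarrow>\<^sub>L 'a) \<Rightarrow> ('a \<Rightarrow>\<^sub>L 'a)" where
  "op_sqrt A = (THE R. nonneg_definite R \<and> R o\<^sub>L R = A)"

end

theory Submission
  imports Defs
begin

text \<open>
  The assertion holds path by path, and reduces to the deterministic inequality
  \<open>\<parallel>\<surd>A - \<surd>B\<parallel>\<^sup>2 \<le> \<parallel>A - B\<parallel>\<close> for bounded non-negative definite operators
  (\<open>op_sqrt_diff_norm_le\<close>), which is then integrated over the probability space.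

  Put \<open>R = \<surd>A\<close>, \<open>S = \<surd>B\<close>, \<open>D = R - S\<close>. If the self-adjoint operator \<open>D\<close> has an
  eigenvector \<open>y\<close> of norm \<open>1\<close> with eigenvalue \<open>\<plusminus>\<parallel>D\<parallel>\<close>, then
  \<open>\<langle>(A - B) y, y\<rangle> = \<langle>(R - S) y, (R + S) y\<rangle> = \<plusminus>\<parallel>D\<parallel> \<langle>y, (R + S) y\<rangle>\<close>, and
  \<open>\<langle>y, (R + S) y\<rangle> \<ge> \<bar>\<langle>y, D y\<rangle>\<bar> = \<parallel>D\<parallel>\<close> because \<open>R\<close> and \<open>S\<close> are non-negative. In general
  \<open>\<parallel>D\<parallel>\<close> or \<open>-\<parallel>D\<parallel>\<close> is only an approximate eigenvalue, which is enough
  (\<open>nonneg_definite_diff_norm_le\<close>). The inequality also shows that a non-negative root is unique;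
  its existence is obtained from a fixed-point iteration (\<open>nonneg_definite_root_exists\<close>), so
  that the definite description defining \<open>op_sqrt\<close> denotes a root.

  Positivity of the processes is given for each fixed time, with an exceptional null set that
  depends on the time. The paths are right-continuous and positivity is a closed condition, so
  positivity at all rational times gives positivity at all times outside one null set
  (\<open>AE_nonneg_definite_all_times\<close>).
\<close>

section \<open>Square roots and the operator norm\<close>

text \<open>
  Let \<open>d = \<parallel>D\<parallel>\<close>. If a unit vector \<open>x\<close> almost maximizes \<open>\<parallel>D x\<parallel>\<close>, then \<open>D\<^sup>2 x\<close> is close to
  \<open>d\<^sup>2 x\<close>, that is, \<open>(D - d) (D + d) x\<close> is close to \<open>0\<close>. Hence \<open>D x + d x\<close> and \<open>D x - d x\<close> are almost
  eigenvectors for \<open>d\<close> and \<open>-d\<close>, and they cannot both be short, since their difference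
  is \<open>2 d x\<close>.
\<close>

lemma selfadjoint_approx_eigenvector:
  fixes D :: "'a::real_inner \<Rightarrow>\<^sub>L 'a"
  assumes sa: "\<And>x y. D x \<bullet> y = x \<bullet> D y" and D: "norm D > 0" and \<epsilon>: "\<epsilon> > 0"
  shows "\<exists>y \<sigma>. y \<noteq> 0 \<and> \<bar>\<sigma>\<bar> = norm D \<and> norm (D y - \<sigma> *\<^sub>R y) \<le> \<epsilon> * norm y"
proof -
  define d where "d = norm D"
  have d: "d > 0" using D by (simp add: d_def)
  \<comment> \<open>With this threshold the residual of \<open>D\<^sup>2 x = d\<^sup>2 x\<close> is at most \<open>\<epsilon> d \<parallel>x\<parallel>\<close>.\<close>
  define q where "q = d\<^sup>2 - \<epsilon>\<^sup>2 / 2"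
  have q: "sqrt (max 0 q) < d"
    using d \<epsilon> by (intro real_less_lsqrt) (auto simp: q_def)
  have "\<exists>x. norm (D x) > sqrt (max 0 q) * norm x"
  proof (rule ccontr)
    assume "\<not> ?thesis"
    then have "norm D \<le> sqrt (max 0 q)"
      by (intro norm_blinfun_bound) (auto simp: not_less)
    then show False using q by (simp add: d_def)
  qed
  then obtain x where x: "norm (D x) > sqrt (max 0 q) * norm x" by blast
  have x0: "norm x > 0" using x by (cases "x = 0") auto
  have "(sqrt (max 0 q) * norm x)\<^sup>2 \<le> (norm (D x))\<^sup>2"
    using x by (intro power_mono) auto
  then have "max 0 q * (norm x)\<^sup>2 \<le> (norm (D x))\<^sup>2"
    by (simp add: power_mult_distrib)
  moreover have "q * (norm x)\<^sup>2 \<le> max 0 q * (norm x)\<^sup>2" by (intro mult_right_mono) auto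
  ultimately have qx: "q * (norm x)\<^sup>2 \<le> (norm (D x))\<^sup>2" by linarith
  let ?z = "D (D x) - d\<^sup>2 *\<^sub>R x"
  have DDx: "norm (D (D x)) \<le> d * (d * norm x)"
    unfolding d_def by (meson mult_left_mono norm_blinfun norm_ge_zero order_trans)
  have "(norm ?z)\<^sup>2 = (norm (D (D x)))\<^sup>2 - 2 * d\<^sup>2 * (D (D x) \<bullet> x) + (d\<^sup>2)\<^sup>2 * (norm x)\<^sup>2"
    unfolding power2_norm_eq_inner by (simp add: inner_diff inner_commute power2_eq_square algebra_simps)
  also have "D (D x) \<bullet> x = (norm (D x))\<^sup>2" by (simp add: sa power2_norm_eq_inner)
  also have "(norm (D (D x)))\<^sup>2 \<le> (d * (d * norm x))\<^sup>2" using DDx by (intro power_mono) auto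
  also have "(d * (d * norm x))\<^sup>2 - 2 * d\<^sup>2 * (norm (D x))\<^sup>2 + (d\<^sup>2)\<^sup>2 * (norm x)\<^sup>2
      = 2 * d\<^sup>2 * (d\<^sup>2 * (norm x)\<^sup>2 - (norm (D x))\<^sup>2)"
    by (simp add: power_mult_distrib power2_eq_square algebra_simps)
  also have "\<dots> \<le> 2 * d\<^sup>2 * (\<epsilon>\<^sup>2 / 2 * (norm x)\<^sup>2)"
    using qx by (intro mult_left_mono) (auto simp: q_def algebra_simps)
  also have "\<dots> = (\<epsilon> * (d * norm x))\<^sup>2" by (simp add: power_mult_distrib mult_ac)
  finally have "(norm ?z)\<^sup>2 \<le> (\<epsilon> * (d * norm x))\<^sup>2" by simp
  then have z: "norm ?z \<le> \<epsilon> * (d * norm x)"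
    by (rule power2_le_imp_le) (use \<epsilon> d x0 in simp)
  define y where "y \<sigma> = D x + \<sigma> *\<^sub>R x" for \<sigma> :: real
  have res: "D (y \<sigma>) - \<sigma> *\<^sub>R y \<sigma> = ?z" if "\<bar>\<sigma>\<bar> = d" for \<sigma>
  proof -
    have "\<sigma> * \<sigma> = d\<^sup>2" using that by (metis power2_abs power2_eq_square)
    then show ?thesis
      by (simp add: y_def blinfun.add_right blinfun.scaleR_right algebra_simps)
  qed
  have "2 * (d * norm x) = norm (y d - y (- d))"
    using d by (simp add: y_def scaleR_2[symmetric] flip: scaleR_left.add)
  also have "\<dots> \<le> norm (y d) + norm (y (- d))" by (rule norm_triangle_ineq4)
  finally have "d * norm x \<le> norm (y d) \<or> d * norm x \<le> norm (y (- d))" by linarith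
  then obtain \<sigma> where \<sigma>: "\<bar>\<sigma>\<bar> = d" "d * norm x \<le> norm (y \<sigma>)"
    using d by (metis abs_minus_cancel abs_of_pos)
  have "norm (D (y \<sigma>) - \<sigma> *\<^sub>R y \<sigma>) \<le> \<epsilon> * norm (y \<sigma>)"
    unfolding res[OF \<sigma>(1)] using z \<sigma>(2) \<epsilon> by (meson mult_left_mono order_trans less_imp_le)
  moreover have "y \<sigma> \<noteq> 0" using \<sigma>(2) d x0 by (metis mult_pos_pos norm_zero not_less)
  ultimately show ?thesis using \<sigma>(1) unfolding d_def by blast
qed

text \<open>
  For an approximate eigenvector \<open>y\<close> of \<open>R - S\<close> with eigenvalue \<open>\<sigma> = \<plusminus>\<parallel>R - S\<parallel>\<close>, the quadratic form
  of \<open>R\<^sup>2 - S\<^sup>2\<close> at \<open>y\<close> is \<open>\<langle>(R - S) y, (R + S) y\<rangle>\<close>, hence almost \<open>\<sigma> \<langle>y, (R + S) y\<rangle>\<close>.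
\<close>

lemma nonneg_definite_diff_norm_le:
  fixes R S :: "'a::real_inner \<Rightarrow>\<^sub>L 'a"
  assumes R: "nonneg_definite R" and S: "nonneg_definite S"
  shows "(norm (R - S))\<^sup>2 \<le> norm ((R o\<^sub>L R) - (S o\<^sub>L S))"
proof (cases "norm (R - S) = 0")
  case False
  define D where "D = R - S"
  define T where "T = R + S"
  define d where "d = norm D"
  define K where "K = norm ((R o\<^sub>L R) - (S o\<^sub>L S))"
  have d: "d > 0" using False by (simp add: d_def D_def)
  have saR: "R x \<bullet> y = x \<bullet> R y" and saS: "S x \<bullet> y = x \<bullet> S y"
    and pos: "0 \<le> R x \<bullet> x" "0 \<le> S x \<bullet> x" for x y
    using R S by (auto simp: nonneg_definite_def)
  have saD: "D x \<bullet> y = x \<bullet> D y" for x y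
    by (simp add: D_def blinfun.diff_left inner_diff saR saS)
  have bound: "d\<^sup>2 \<le> K + \<epsilon> * (d + norm T)" if \<epsilon>: "\<epsilon> > 0" for \<epsilon>
  proof -
    obtain y \<sigma> where y: "y \<noteq> 0" and \<sigma>: "\<bar>\<sigma>\<bar> = d" and res: "norm (D y - \<sigma> *\<^sub>R y) \<le> \<epsilon> * norm y"
      using selfadjoint_approx_eigenvector[of D \<epsilon>] saD d \<epsilon> unfolding d_def by blast
    let ?z = "D y - \<sigma> *\<^sub>R y" and ?n = "(norm y)\<^sup>2"
    have Dyy: "D y \<bullet> y = \<sigma> * ?n + ?z \<bullet> y"
      by (simp add: inner_diff power2_norm_eq_inner)
    have "\<bar>?z \<bullet> y\<bar> \<le> norm ?z * norm y" by (rule Cauchy_Schwarz_ineq2)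
    also have "\<dots> \<le> \<epsilon> * norm y * norm y" using res by (intro mult_right_mono) auto
    finally have zy: "\<bar>?z \<bullet> y\<bar> \<le> \<epsilon> * ?n" by (simp add: power2_eq_square)
    have "\<bar>\<sigma> * ?n\<bar> = d * ?n" using \<sigma> by (simp add: abs_mult)
    then have "d * ?n - \<epsilon> * ?n \<le> \<bar>D y \<bullet> y\<bar>" using Dyy zy by linarith
    also have "\<dots> \<le> T y \<bullet> y"
      using pos[of y] by (simp add: D_def T_def blinfun.diff_left blinfun.add_left inner_diff inner_add abs_le_iff)
    finally have Tyy: "d * ?n - \<epsilon> * ?n \<le> T y \<bullet> y" .
    have "\<bar>?z \<bullet> T y\<bar> \<le> norm ?z * norm (T y)" by (rule Cauchy_Schwarz_ineq2)
    also have "\<dots> \<le> (\<epsilon> * norm y) * (norm T * norm y)"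
      using res \<epsilon> by (intro mult_mono norm_blinfun) auto
    finally have zT: "\<bar>?z \<bullet> T y\<bar> \<le> \<epsilon> * norm T * ?n" by (simp add: power2_eq_square mult_ac)
    have form: "((R o\<^sub>L R) - (S o\<^sub>L S)) y \<bullet> y = \<sigma> * (T y \<bullet> y) + ?z \<bullet> T y"
      using saR[of "R y" y] saS[of "S y" y] saR[of y "S y"] saS[of y "R y"]
      by (simp add: D_def T_def blinfun.diff_left blinfun.add_left inner_diff inner_add inner_commute algebra_simps)
    have "d * (d * ?n - \<epsilon> * ?n) \<le> d * (T y \<bullet> y)" using Tyy d by (intro mult_left_mono) auto
    also have "\<dots> \<le> \<bar>\<sigma> * (T y \<bullet> y)\<bar>"
      using \<sigma> d by (simp add: abs_mult mult_left_mono)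
    also have "\<dots> \<le> \<bar>((R o\<^sub>L R) - (S o\<^sub>L S)) y \<bullet> y\<bar> + \<epsilon> * norm T * ?n"
      using form zT by linarith
    also have "\<bar>((R o\<^sub>L R) - (S o\<^sub>L S)) y \<bullet> y\<bar> \<le> norm (((R o\<^sub>L R) - (S o\<^sub>L S)) y) * norm y"
      by (rule Cauchy_Schwarz_ineq2)
    also have "\<dots> \<le> (K * norm y) * norm y"
      unfolding K_def by (intro mult_right_mono norm_blinfun) auto
    finally have "d\<^sup>2 * ?n \<le> (K + \<epsilon> * (d + norm T)) * ?n"
      by (simp add: power2_eq_square algebra_simps)
    then show ?thesis using y by (simp add: mult_le_cancel_right)
  qed
  have "d\<^sup>2 \<le> K"
  proof (rule field_le_epsilon)
    fix e :: real assume e: "e > 0"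
    have c: "d + norm T > 0" using d by (simp add: add_pos_nonneg)
    show "d\<^sup>2 \<le> K + e" using bound[of "e / (d + norm T)"] e c by simp
  qed
  then show ?thesis by (simp add: d_def D_def K_def)
qed simp

text \<open>
  A non-negative definite contraction satisfies \<open>\<parallel>A x\<parallel>\<^sup>2 \<le> \<langle>A x, x\<rangle>\<close>, as one sees by testing
  positivity on \<open>x - A x\<close>; expanding \<open>\<parallel>x - A x\<parallel>\<^sup>2\<close> then gives the bound.
\<close>

lemma norm_id_minus_nonneg_definite:
  fixes A :: "'a::real_inner \<Rightarrow>\<^sub>L 'a"
  assumes A: "nonneg_definite A" and A1: "norm A \<le> 1"
  shows "norm (id_blinfun - A) \<le> 1"
proof (rule norm_blinfun_bound)
  fix x
  have sa: "A x \<bullet> y = x \<bullet> A y" and pos: "0 \<le> A x \<bullet> x" for x y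
    using A by (auto simp: nonneg_definite_def)
  have contr: "norm (A v) \<le> norm v" for v
    using norm_blinfun[of A v] mult_right_mono[OF A1, of "norm v"] by simp
  have "A (A x) \<bullet> A x \<le> norm (A (A x)) * norm (A x)" by (rule norm_cauchy_schwarz)
  also have "\<dots> \<le> norm (A x) * norm (A x)" using contr by (intro mult_right_mono) auto
  finally have "A (A x) \<bullet> A x \<le> A x \<bullet> A x" by (simp add: dot_square_norm power2_eq_square)
  moreover have "A (x - A x) \<bullet> (x - A x) = A x \<bullet> x - 2 * (A x \<bullet> A x) + A (A x) \<bullet> A x"
    by (simp add: blinfun.diff_right inner_diff sa[of "A x" x])
  ultimately have "A x \<bullet> A x \<le> A x \<bullet> x" using pos[of "x - A x"] by linarith
  moreover have "(norm (x - A x))\<^sup>2 = (norm x)\<^sup>2 - 2 * (A x \<bullet> x) + A x \<bullet> A x"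
    unfolding power2_norm_eq_inner by (simp add: inner_diff inner_commute)
  ultimately have "(norm (x - A x))\<^sup>2 \<le> (norm x)\<^sup>2" using pos[of x] by linarith
  then have "norm (x - A x) \<le> norm x" by (rule power2_le_imp_le) simp
  then show "norm ((id_blinfun - A) x) \<le> 1 * norm x" by (simp add: blinfun.diff_left)
qed simp

text \<open>
  Writing a root of \<open>A = I - B\<close> as \<open>I - Y\<close> turns \<open>(I - Y)\<^sup>2 = A\<close> into the fixed-point equation
  \<open>Y = (B + Y\<^sup>2) / 2\<close>. When \<open>\<parallel>B\<parallel> \<le> 1\<close>, its iterates started at \<open>0\<close> are dominated, increment by increment,
  by those of the scalar equation \<open>y = (1 + y\<^sup>2) / 2\<close>, which increase and do not exceed \<open>1\<close>.
  They therefore converge in operator norm.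
\<close>

primrec root_iterate :: "('a::real_normed_vector \<Rightarrow>\<^sub>L 'a) \<Rightarrow> nat \<Rightarrow> ('a \<Rightarrow>\<^sub>L 'a)" where
  "root_iterate B 0 = 0"
| "root_iterate B (Suc k) = (B + (root_iterate B k o\<^sub>L root_iterate B k)) /\<^sub>R 2"

primrec root_majorant :: "nat \<Rightarrow> real" where
  "root_majorant 0 = 0"
| "root_majorant (Suc k) = (1 + (root_majorant k)\<^sup>2) / 2"

lemma root_majorant_bounds: "0 \<le> root_majorant k" "root_majorant k \<le> 1"
  by (induction k) (auto simp: power_le_one)

lemma root_majorant_mono: "incseq root_majorant"
proof (rule incseq_SucI)
  show "root_majorant k \<le> root_majorant (Suc k)" for k
    using sum_squares_bound[of 1 "root_majorant k"] by simp
qed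

lemma root_iterate_norm_le:
  assumes "norm B \<le> 1"
  shows "norm (root_iterate B k) \<le> root_majorant k"
proof (induction k)
  case (Suc k)
  let ?Y = "root_iterate B k"
  have "norm (?Y o\<^sub>L ?Y) \<le> norm ?Y * norm ?Y" by (rule norm_blinfun_compose)
  also have "\<dots> \<le> (root_majorant k)\<^sup>2"
    unfolding power2_eq_square using Suc root_majorant_bounds by (intro mult_mono) auto
  finally show ?case
    using norm_triangle_ineq[of B "?Y o\<^sub>L ?Y"] assms by simp
qed simp

lemma root_iterate_increment_le:
  assumes "norm B \<le> 1"
  shows "norm (root_iterate B (Suc k) - root_iterate B k) \<le> root_majorant (Suc k) - root_majorant k"
proof (induction k)
  case 0
  then show ?case using assms by simp
next
  case (Suc k)
  let ?Y = "root_iterate B k" and ?Z = "root_iterate B (Suc k)"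
  let ?y = "root_majorant k" and ?z = "root_majorant (Suc k)"
  have YZ: "norm ?Y \<le> ?y" "norm ?Z \<le> ?z" using root_iterate_norm_le[OF assms] by blast+
  have y: "0 \<le> ?y" "0 \<le> ?z" using root_majorant_bounds by blast+
  have yz: "?y \<le> ?z" using root_majorant_mono by (rule incseq_SucD)
  have eq: "(?Z o\<^sub>L ?Z) - (?Y o\<^sub>L ?Y) = (?Z o\<^sub>L (?Z - ?Y)) + ((?Z - ?Y) o\<^sub>L ?Y)"
    by (rule blinfun_eqI)
      (simp add: blinfun.diff_left blinfun.diff_right blinfun.add_left del: root_iterate.simps)
  have "norm ((?Z o\<^sub>L ?Z) - (?Y o\<^sub>L ?Y)) \<le> norm (?Z o\<^sub>L (?Z - ?Y)) + norm ((?Z - ?Y) o\<^sub>L ?Y)"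
    unfolding eq by (rule norm_triangle_ineq)
  also have "\<dots> \<le> norm ?Z * norm (?Z - ?Y) + norm (?Z - ?Y) * norm ?Y"
    by (intro add_mono norm_blinfun_compose)
  also have "\<dots> \<le> ?z * (?z - ?y) + (?z - ?y) * ?y"
    using YZ y yz Suc
    by (intro add_mono mult_mono) (simp_all del: root_iterate.simps root_majorant.simps)
  also have "\<dots> = ?z\<^sup>2 - ?y\<^sup>2" by (simp add: power2_eq_square algebra_simps)
  finally have "norm ((?Z o\<^sub>L ?Z) - (?Y o\<^sub>L ?Y)) \<le> ?z\<^sup>2 - ?y\<^sup>2" .
  moreover have "root_iterate B (Suc (Suc k)) - ?Z = ((?Z o\<^sub>L ?Z) - (?Y o\<^sub>L ?Y)) /\<^sub>R 2"
    by (simp add: algebra_simps)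
  moreover have "root_majorant (Suc (Suc k)) - ?z = (?z\<^sup>2 - ?y\<^sup>2) / 2"
    by (simp add: field_simps power2_eq_square)
  ultimately show ?case by (simp del: root_iterate.simps root_majorant.simps)
qed

lemma root_iterate_convergent:
  fixes B :: "'a::banach \<Rightarrow>\<^sub>L 'a"
  assumes "norm B \<le> 1"
  shows "convergent (root_iterate B)"
proof -
  have "convergent root_majorant"
    by (rule Bseq_mono_convergent)
      (use root_majorant_bounds root_majorant_mono in \<open>auto simp: incseq_def intro!: BseqI'[of _ 1]\<close>)
  then have "summable (\<lambda>k. root_majorant (Suc k) - root_majorant k)"
    unfolding convergent_def using telescope_summable by blast
  then have "summable (\<lambda>k. root_iterate B (Suc k) - root_iterate B k)"
    by (rule summable_comparison_test'[where N = 0]) (rule root_iterate_increment_le[OF assms])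
  then have "convergent (\<lambda>n. \<Sum>k<n. root_iterate B (Suc k) - root_iterate B k)"
    by (simp add: summable_iff_convergent)
  then show ?thesis by (simp only: sum_lessThan_telescope root_iterate.simps(1) diff_0_right)
qed

lemma root_iterate_selfadjoint:
  fixes B :: "'a::real_inner \<Rightarrow>\<^sub>L 'a"
  assumes "\<And>x y. B x \<bullet> y = x \<bullet> B y"
  shows "root_iterate B k x \<bullet> y = x \<bullet> root_iterate B k y"
  by (induction k arbitrary: x y)
    (simp_all add: assms blinfun.scaleR_left blinfun.add_left inner_add)

lemma nonneg_definite_scaleR:
  "nonneg_definite A \<Longrightarrow> 0 \<le> c \<Longrightarrow> nonneg_definite (c *\<^sub>R A)"
  by (auto simp: nonneg_definite_def blinfun.scaleR_left)

text \<open>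
  The limit \<open>Y\<close> of the iteration is self-adjoint with norm at most \<open>1\<close>, so \<open>\<langle>Y x, x\<rangle> \<le> \<parallel>x\<parallel>\<^sup>2\<close>
  and \<open>I - Y\<close> is non-negative definite.
\<close>

lemma nonneg_definite_contraction_root_exists:
  fixes A :: "'a::{real_inner,banach} \<Rightarrow>\<^sub>L 'a"
  assumes A: "nonneg_definite A" and A1: "norm A \<le> 1"
  shows "\<exists>R. nonneg_definite R \<and> R o\<^sub>L R = A"
proof -
  define B where "B = id_blinfun - A"
  have B: "norm B \<le> 1" unfolding B_def by (rule norm_id_minus_nonneg_definite[OF A A1])
  have saB: "B x \<bullet> y = x \<bullet> B y" for x y
    using A by (simp add: B_def nonneg_definite_def blinfun.diff_left inner_diff)
  obtain Y where Y: "root_iterate B \<longlonglongrightarrow> Y"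
    using root_iterate_convergent[OF B] by (auto simp: convergent_def)
  have compose: "(\<lambda>k. root_iterate B k o\<^sub>L root_iterate B k) \<longlonglongrightarrow> (Y o\<^sub>L Y)"
    by (rule bounded_bilinear.tendsto[OF bounded_bilinear_blinfun_compose Y Y])
  have "(\<lambda>k. root_iterate B (Suc k)) \<longlonglongrightarrow> (B + (Y o\<^sub>L Y)) /\<^sub>R 2"
    unfolding root_iterate.simps by (intro tendsto_intros compose)
  then have fixpoint: "Y = (B + (Y o\<^sub>L Y)) /\<^sub>R 2"
    using LIMSEQ_Suc[OF Y] LIMSEQ_unique by blast
  have "norm (root_iterate B k) \<le> 1" for k
    using root_iterate_norm_le[OF B, of k] root_majorant_bounds[of k] by linarith
  then have Y1: "norm Y \<le> 1"
    by (intro tendsto_upperbound[OF tendsto_norm[OF Y]]) auto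
  have saY: "Y x \<bullet> y = x \<bullet> Y y" for x y
  proof (rule LIMSEQ_unique)
    show "(\<lambda>k. root_iterate B k x \<bullet> y) \<longlonglongrightarrow> Y x \<bullet> y" by (intro tendsto_intros Y)
    show "(\<lambda>k. root_iterate B k x \<bullet> y) \<longlonglongrightarrow> x \<bullet> Y y"
      unfolding root_iterate_selfadjoint[of B, OF saB] by (intro tendsto_intros Y)
  qed
  have "Y x \<bullet> x \<le> x \<bullet> x" for x
  proof -
    have "Y x \<bullet> x \<le> norm (Y x) * norm x" by (rule norm_cauchy_schwarz)
    also have "\<dots> \<le> (1 * norm x) * norm x"
      using Y1 by (intro mult_right_mono order_trans[OF norm_blinfun]) auto
    finally show ?thesis by (simp add: dot_square_norm power2_eq_square)
  qed
  then have "nonneg_definite (id_blinfun - Y)"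
    by (simp add: nonneg_definite_def blinfun.diff_left inner_diff saY)
  moreover have "(id_blinfun - Y) o\<^sub>L (id_blinfun - Y) = A"
  proof (rule blinfun_eqI)
    fix x
    have "2 *\<^sub>R Y x = 2 *\<^sub>R ((B + (Y o\<^sub>L Y)) /\<^sub>R 2) x" using fixpoint by simp
    then have "2 *\<^sub>R Y x = x - A x + Y (Y x)"
      by (simp add: blinfun.scaleR_left blinfun.add_left B_def blinfun.diff_left)
    then show "((id_blinfun - Y) o\<^sub>L (id_blinfun - Y)) x = A x"
      by (simp add: blinfun.diff_left blinfun.diff_right scaleR_2 algebra_simps)
  qed
  ultimately show ?thesis by blast
qed

lemma nonneg_definite_root_exists:
  fixes A :: "'a::{real_inner,banach} \<Rightarrow>\<^sub>L 'a"
  assumes A: "nonneg_definite A"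
  shows "\<exists>R. nonneg_definite R \<and> R o\<^sub>L R = A"
proof -
  define c where "c = norm A + 1"
  have c: "c > 0" by (simp add: c_def add_nonneg_pos)
  have "norm (A /\<^sub>R c) \<le> 1" using c by (simp add: c_def field_simps)
  then obtain R where R: "nonneg_definite R" "R o\<^sub>L R = A /\<^sub>R c"
    using nonneg_definite_contraction_root_exists[of "A /\<^sub>R c"] nonneg_definite_scaleR[OF A, of "inverse c"] c
    by auto
  have "(sqrt c *\<^sub>R R) o\<^sub>L (sqrt c *\<^sub>R R) = c *\<^sub>R (R o\<^sub>L R)"
    using c by (intro blinfun_eqI) (simp add: blinfun.scaleR_left blinfun.scaleR_right)
  also have "\<dots> = A" using R c by simp
  finally have "(sqrt c *\<^sub>R R) o\<^sub>L (sqrt c *\<^sub>R R) = A" .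
  moreover have "nonneg_definite (sqrt c *\<^sub>R R)"
    using c by (intro nonneg_definite_scaleR R(1)) simp
  ultimately show ?thesis by blast
qed

lemma op_sqrt_root:
  fixes A :: "'a::{real_inner,banach} \<Rightarrow>\<^sub>L 'a"
  assumes "nonneg_definite A"
  shows "nonneg_definite (op_sqrt A)" "op_sqrt A o\<^sub>L op_sqrt A = A"
proof -
  have "R = S" if "nonneg_definite R" "R o\<^sub>L R = A" "nonneg_definite S" "S o\<^sub>L S = A" for R S
    using nonneg_definite_diff_norm_le[OF that(1,3)] that(2,4) by simp
  then have "\<exists>!R. nonneg_definite R \<and> R o\<^sub>L R = A"
    using nonneg_definite_root_exists[OF assms] by blast
  from theI'[OF this] show "nonneg_definite (op_sqrt A)" "op_sqrt A o\<^sub>L op_sqrt A = A"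
    by (auto simp: op_sqrt_def)
qed

lemma op_sqrt_diff_norm_le:
  fixes A B :: "'a::{real_inner,banach} \<Rightarrow>\<^sub>L 'a"
  assumes "nonneg_definite A" "nonneg_definite B"
  shows "(norm (op_sqrt A - op_sqrt B))\<^sup>2 \<le> norm (A - B)"
  using nonneg_definite_diff_norm_le[of "op_sqrt A" "op_sqrt B"] op_sqrt_root assms by metis

section \<open>Positivity along whole paths\<close>

text \<open>
  The driving path is constant immediately to the right of every time, since the counting path is
  right-continuous with values in a discrete space; the remaining integral term is continuous.
\<close>

lemma langevin_path_right_continuous:
  fixes A :: "'b::banach \<Rightarrow>\<^sub>L 'b"
  assumes n: "cadlag n" and v: "langevin_path A v0 (jump_sum n x) v" and t: "0 \<le> t"
  shows "(v \<longlongrightarrow> v t) (at_right t)"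
proof -
  let ?I = "\<lambda>s. integral {0..s} (\<lambda>u. A (v u))" and ?l = "jump_sum n x"
  have int: "((\<lambda>u. A (v u)) has_integral (v s - v0 - ?l s)) {0..s}" if "0 \<le> s" for s
    using v that by (simp add: langevin_path_def)
  have v_eq: "v s = v0 + ?l s + ?I s" if "0 \<le> s" for s
    using integral_unique[OF int[OF that]] by simp
  have "continuous_on {0..t + 1} ?I"
    using int[of "t + 1"] t by (intro indefinite_integral_continuous_1) (auto simp: integrable_on_def)
  then have "(?I \<longlongrightarrow> ?I t) (at t within {0..t + 1})"
    using t by (auto simp: continuous_on_def)
  then have "(?I \<longlongrightarrow> ?I t) (at t within {t..t + 1})"
    by (rule tendsto_within_subset) (use t in auto)
  then have I: "(?I \<longlongrightarrow> ?I t) (at_right t)"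
    by (simp add: at_within_Icc_at_right)
  have "(n \<longlongrightarrow> n t) (at_right t)" using n t by (simp add: cadlag_def)
  then have "\<forall>\<^sub>F s in at_right t. n s = n t" by (rule tendsto_discrete[THEN iffD1])
  then have "\<forall>\<^sub>F s in at_right t. v0 + ?l t + ?I s = v s"
    using eventually_at_right_less[of t]
    by eventually_elim (use t v_eq in \<open>auto simp: jump_sum_def\<close>)
  moreover have "((\<lambda>s. v0 + ?l t + ?I s) \<longlongrightarrow> v0 + ?l t + ?I t) (at_right t)"
    by (intro tendsto_intros I)
  ultimately show ?thesis unfolding v_eq[OF t] by (rule Lim_transform_eventually[rotated])
qed

lemma right_continuous_in_closed_set_if_rationals:
  fixes f :: "real \<Rightarrow> 'b::topological_space"
  assumes lim: "(f \<longlongrightarrow> f t) (at_right t)" and "0 \<le> t" and "closed C"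
    and rat: "\<And>q. q \<in> \<rat> \<Longrightarrow> 0 \<le> q \<Longrightarrow> f q \<in> C"
  shows "f t \<in> C"
proof (rule ccontr)
  assume "f t \<notin> C"
  then have "\<forall>\<^sub>F s in at_right t. f s \<in> - C"
    using lim \<open>closed C\<close> by (intro topological_tendstoD) (auto simp: open_Compl)
  then obtain b where b: "b > t" "\<And>s. t < s \<Longrightarrow> s < b \<Longrightarrow> f s \<in> - C"
    by (auto simp: eventually_at_right_field)
  obtain q where "q \<in> \<rat>" "t < q" "q < b" using Rats_dense_in_real[OF b(1)] by blast
  then show False using b(2)[of q] rat[of q] \<open>0 \<le> t\<close> by auto
qed

lemma closed_nonneg_definite: "closed {A :: 'a::real_inner \<Rightarrow>\<^sub>L 'a. nonneg_definite A}"
  unfolding nonneg_definite_def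
  by (intro closed_Collect_conj closed_Collect_all closed_Collect_eq closed_Collect_le continuous_intros)

lemma (in prob_space) AE_nonneg_definite_all_times:
  fixes V :: "real \<Rightarrow> 'a \<Rightarrow> 'b::{real_inner,banach} hs"
  assumes N: "compound_poisson N rate X" and V: "variance_process C V0 N X V"
    and nonneg: "\<And>t. t \<ge> 0 \<Longrightarrow> AE \<omega> in M. nonneg_definite (hs_op (V t \<omega>))"
  shows "AE \<omega> in M. \<forall>t\<ge>0. nonneg_definite (hs_op (V t \<omega>))"
proof -
  have "AE \<omega> in M. cadlag (\<lambda>t. N t \<omega>)"
    using N by (simp add: compound_poisson_def poisson_process_def)
  moreover have "AE \<omega> in M. langevin_path C (V0 \<omega>) (jump_sum (\<lambda>t. N t \<omega>) (\<lambda>i. X i \<omega>)) (\<lambda>t. V t \<omega>)"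
    using V by (simp add: variance_process_def)
  moreover have "AE \<omega> in M. \<forall>q\<in>\<rat> \<inter> {0..}. nonneg_definite (hs_op (V q \<omega>))"
    using nonneg by (subst AE_ball_countable) (auto intro: countable_Int1 countable_rat)
  ultimately show ?thesis
  proof eventually_elim
    case (elim \<omega>)
    show ?case
    proof (intro allI impI)
      fix t :: real assume t: "t \<ge> 0"
      have "((\<lambda>s. hs_op (V s \<omega>)) \<longlongrightarrow> hs_op (V t \<omega>)) (at_right t)"
        by (rule bounded_linear.tendsto[OF bounded_linear_hs_op langevin_path_right_continuous[OF elim(1,2) t]])
      from right_continuous_in_closed_set_if_rationals[OF this t closed_nonneg_definite]
      show "nonneg_definite (hs_op (V t \<omega>))" using elim(3) by auto
    qed
  qed
qed

section \<open>Square roots of variance processes\<close>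

theorem proposition7:
  fixes M :: "'w measure"
    and \<C> :: "'a::{real_inner,banach,second_countable_topology} hs \<Rightarrow>\<^sub>L 'a hs"
    and \<C>n :: "nat \<Rightarrow> 'a hs \<Rightarrow>\<^sub>L 'a hs"
    and V0 :: "'w \<Rightarrow> 'a hs" and V0n :: "nat \<Rightarrow> 'w \<Rightarrow> 'a hs"
    and N :: "real \<Rightarrow> 'w \<Rightarrow> nat" and rate :: real
    and X :: "nat \<Rightarrow> 'w \<Rightarrow> 'a hs" and Xn :: "nat \<Rightarrow> nat \<Rightarrow> 'w \<Rightarrow> 'a hs"
    and V :: "real \<Rightarrow> 'w \<Rightarrow> 'a hs" and Vn :: "nat \<Rightarrow> real \<Rightarrow> 'w \<Rightarrow> 'a hs"
  assumes "prob_space M" and "rate > 0"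
    and "V0 \<in> borel_measurable M" and "\<And>n. V0n n \<in> borel_measurable M"
    and "prob_space.compound_poisson M N rate X"
    and "\<And>n. prob_space.compound_poisson M N rate (Xn n)"
    and "prob_space.variance_process M \<C> V0 N X V"
    and "\<And>n. prob_space.variance_process M (\<C>n n) (V0n n) N (Xn n) (Vn n)"
    and "\<And>t. t \<ge> 0 \<Longrightarrow> AE \<omega> in M. nonneg_definite (hs_op (V t \<omega>))"
    and "\<And>n t. t \<ge> 0 \<Longrightarrow> AE \<omega> in M. nonneg_definite (hs_op (Vn n t \<omega>))"
  shows "\<forall>n. \<forall>T>0.
    (\<integral>\<^sup>+ \<omega>. (SUP t\<in>{0..T}.
        ennreal ((norm (op_sqrt (hs_op (V t \<omega>)) - op_sqrt (hs_op (Vn n t \<omega>))))\<^sup>2)) \<partial>M)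
    \<le> (\<integral>\<^sup>+ \<omega>. (SUP t\<in>{0..T}. ennreal (norm (hs_op (V t \<omega>) - hs_op (Vn n t \<omega>)))) \<partial>M)"
proof (intro allI impI)
  fix n :: nat and T :: real assume "T > 0"
  interpret prob_space M by fact
  have "AE \<omega> in M. \<forall>t\<ge>0. nonneg_definite (hs_op (V t \<omega>))"
    using assms by (intro AE_nonneg_definite_all_times) auto
  moreover have "AE \<omega> in M. \<forall>t\<ge>0. nonneg_definite (hs_op (Vn n t \<omega>))"
    by (rule AE_nonneg_definite_all_times) (fact assms)+
  ultimately have "AE \<omega> in M. (SUP t\<in>{0..T}.
        ennreal ((norm (op_sqrt (hs_op (V t \<omega>)) - op_sqrt (hs_op (Vn n t \<omega>))))\<^sup>2))
      \<le> (SUP t\<in>{0..T}. ennreal (norm (hs_op (V t \<omega>) - hs_op (Vn n t \<omega>))))"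
    by eventually_elim (auto intro!: SUP_subset_mono ennreal_leI op_sqrt_diff_norm_le)
  then show "(\<integral>\<^sup>+ \<omega>. (SUP t\<in>{0..T}.
        ennreal ((norm (op_sqrt (hs_op (V t \<omega>)) - op_sqrt (hs_op (Vn n t \<omega>))))\<^sup>2)) \<partial>M)
    \<le> (\<integral>\<^sup>+ \<omega>. (SUP t\<in>{0..T}. ennreal (norm (hs_op (V t \<omega>) - hs_op (Vn n t \<omega>)))) \<partial>M)"
    by (rule nn_integral_mono_AE)
qed

end
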